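(* Let $F$ be a group generated by a finite set $S$. The set of elements of $F$ of word length $\leq 3|S|$ in $S$ is a Burnside set for $\mathrm{Hom}(F,\mathrm{GL}_2(\mathbb{C}))$.
   Context: The word length of an element $g\in F$ in $S$ is the minimum integer $k\geq 0$ such that $g=s_1\cdots s_k$ for some $s_1,\dots,s_k\in S\cup S^{-1}$. Let $\mathcal{C}$ be a class of group homomorphisms with domain $F$, and let $L\subseteq F$ be a subset. We say that $L$ is a Burnside set for $\mathcal{C}$ if the following two conditions are equivalent for every $\rho\in\mathcal{C}$: (1) $\rho(\gamma)$ is torsion (i.e. has finite order) for all $\gamma\in L$; (2) $\rho$ has finite image. Here $\mathrm{Hom}(F,\mathrm{GL}_2(\mathbb{C}))$ is the set of all group homomorphisms $F\to\mathrm{GL}_2(\mathbb{C})$. *)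

theory Defs
  imports "HOL-Analysis.Analysis" "HOL-Algebra.Algebra"
begin

definition word_value :: "('a, 'm) monoid_scheme \<Rightarrow> 'a list \<Rightarrow> 'a" where
  "word_value F ws = foldr (mult F) ws (one F)"

text \<open>
  The minimum is over a nonempty set of lengths exactly when \<open>g\<close> lies in the subgroup
  generated by \<open>S\<close>; outside that subgroup the value is unspecified.
\<close>

definition word_length :: "('a, 'm) monoid_scheme \<Rightarrow> 'a set \<Rightarrow> 'a \<Rightarrow> nat" where
  "word_length F S g =
     (LEAST k. \<exists>ws. length ws = k \<and> set ws \<subseteq> S \<union> m_inv F ` S \<and> g = word_value F ws)"

lemma (in group) ex_word_if_generate:
  assumes "S \<subseteq> carrier G" "g \<in> generate G S"
  shows "\<exists>ws. set ws \<subseteq> S \<union> m_inv G ` S \<and> g = word_value G ws"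
  using assms(2)
proof induction
  case one
  show ?case by (rule exI[of _ "[]"]) (simp add: word_value_def)
next
  case (incl h)
  then show ?case using assms(1) by (intro exI[of _ "[h]"]) (auto simp: word_value_def)
next
  case (inv h)
  then show ?case using assms(1) by (intro exI[of _ "[inv h]"]) (auto simp: word_value_def)
next
  case (eng h1 h2)
  then obtain us vs where us: "set us \<subseteq> S \<union> m_inv G ` S" "h1 = word_value G us"
    and vs: "set vs \<subseteq> S \<union> m_inv G ` S" "h2 = word_value G vs"
    by blast
  have closed: "word_value G ws \<in> carrier G" if "set ws \<subseteq> S \<union> m_inv G ` S" for ws
    using that assms(1) by (induction ws) (auto simp: word_value_def)
  have "word_value G (us @ vs) = word_value G us \<otimes> word_value G vs"
    using us(1)
  proof (induction us)
    case Nil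
    then show ?case using closed[OF vs(1)] by (simp add: word_value_def)
  next
    case (Cons u us)
    then have "u \<in> carrier G" "word_value G us \<in> carrier G"
      using assms(1) closed by auto
    then show ?case
      using Cons closed[OF vs(1)] by (simp add: word_value_def m_assoc)
  qed
  then show ?case using us vs by (intro exI[of _ "us @ vs"]) auto
qed

definition is_torsion :: "('a, 'm) monoid_scheme \<Rightarrow> 'a \<Rightarrow> bool" where
  "is_torsion G x \<longleftrightarrow> (\<exists>n::nat. n > 0 \<and> x [^]\<^bsub>G\<^esub> n = \<one>\<^bsub>G\<^esub>)"

text \<open>
  A class of homomorphisms with domain \<open>F\<close> is a set of pairs \<open>(G, \<rho>)\<close> of a codomain group and a
  homomorphism \<open>\<rho>\<close> into it. Elements of \<^const>\<open>hom\<close> are arbitrary outside \<open>carrier F\<close>, so the image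
  of \<open>\<rho>\<close> is \<open>\<rho> ` carrier F\<close>.
\<close>

definition hom_class ::
    "('a, 'm) monoid_scheme \<Rightarrow> (('b, 'n) monoid_scheme \<times> ('a \<Rightarrow> 'b)) set \<Rightarrow> bool" where
  "hom_class F C \<longleftrightarrow> (\<forall>(G, \<rho>) \<in> C. group G \<and> \<rho> \<in> hom F G)"

definition Hom :: "('a, 'm) monoid_scheme \<Rightarrow> ('b, 'n) monoid_scheme
    \<Rightarrow> (('b, 'n) monoid_scheme \<times> ('a \<Rightarrow> 'b)) set" where
  "Hom F G = {G} \<times> hom F G"

definition burnside_set :: "('a, 'm) monoid_scheme
    \<Rightarrow> (('b, 'n) monoid_scheme \<times> ('a \<Rightarrow> 'b)) set \<Rightarrow> 'a set \<Rightarrow> bool" where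
  "burnside_set F C L \<longleftrightarrow>
     hom_class F C \<and> L \<subseteq> carrier F \<and>
     (\<forall>(G, \<rho>) \<in> C. (\<forall>\<gamma>\<in>L. is_torsion G (\<rho> \<gamma>)) \<longleftrightarrow> finite (\<rho> ` carrier F))"

definition GL2 :: "(complex ^ 2 ^ 2) monoid" where
  "GL2 = \<lparr>carrier = {A. invertible A}, mult = (**), one = mat 1\<rparr>"

lemma group_GL2: "group GL2"
proof (rule groupI)
  fix A assume "A \<in> carrier GL2"
  then obtain B where B: "A ** B = mat 1" "B ** A = mat 1"
    by (auto simp: GL2_def invertible_def)
  then have "invertible B" by (auto simp: invertible_def)
  with B show "\<exists>B\<in>carrier GL2. B \<otimes>\<^bsub>GL2\<^esub> A = \<one>\<^bsub>GL2\<^esub>"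
    by (auto simp: GL2_def)
qed (auto simp: GL2_def invertible_mult matrix_mul_assoc invertible_def[of "mat 1"])

lemma hom_class_Hom: "group G \<Longrightarrow> hom_class F (Hom F G)"
  by (auto simp: hom_class_def Hom_def)

end

theory Submission
  imports Defs
begin

text \<open>
  Dividing the images of the generators by square roots of their determinants, which are roots of
  unity, one may replace \<open>GL\<^sub>2\<close> by \<open>SL\<^sub>2\<close>. If the normalised generators commute, finiteness is clear.
  Otherwise choose two of them, \<open>A\<close> and \<open>B\<close>, with \<open>A B \<noteq> B A\<close>. Traces of torsion words are sums
  \<open>u + u\<^sup>-\<^sup>1\<close> with \<open>u\<close> a root of unity, so they lie in the real part of some \<open>\<int>[\<zeta>]\<close>, and every Galois
  conjugate \<open>\<sigma>\<close> takes them into \<open>[-2, 2]\<close>. Put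
  \<open>\<Delta> = 2 - tr (A B A\<^sup>-\<^sup>1 B\<^sup>-\<^sup>1)\<close>; this is nonzero, since a torsion element of trace \<open>2\<close> is trivial, and hence
  \<open>\<sigma> \<Delta> > 0\<close> for all \<open>\<sigma>\<close>. The matrices \<open>1, A, B, A B\<close> form a basis of the matrix algebra, and the
  traces of words of length at most three show that the generated group has coordinates in
  \<open>\<int>[\<zeta>]\<close> up to a common denominator. In these coordinates the determinant is a quadratic form all of
  whose conjugates are positive definite because \<open>\<sigma> \<Delta> > 0\<close>. As it takes the value \<open>1\<close> on the group, all
  conjugates of the coordinates are bounded, which leaves finitely many possibilities. The longest
  words needed are commutators of two generators; their length \<open>4\<close> is at most \<open>3 n\<close> as soon as \<open>n \<ge> 2\<close>.
\<close>

subsection \<open>Conjugates of cyclotomic integers\<close>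

definition ipoly :: "int poly \<Rightarrow> complex \<Rightarrow> complex" where
  "ipoly p x = poly (map_poly of_int p) x"

lemma ipoly_0 [simp]: "ipoly 0 x = 0"
  by (simp add: ipoly_def)

lemma ipoly_pCons [simp]: "ipoly (pCons a p) x = of_int a + x * ipoly p x"
  by (simp add: ipoly_def map_poly_pCons)

lemma ipoly_1 [simp]: "ipoly 1 x = 1"
  by (simp add: one_pCons)

lemma ipoly_add [simp]: "ipoly (p + q) x = ipoly p x + ipoly q x"
proof -
  have "map_poly (of_int :: int \<Rightarrow> complex) (p + q) = map_poly of_int p + map_poly of_int q"
    by (rule poly_eqI) (simp add: coeff_map_poly)
  then show ?thesis by (simp add: ipoly_def)
qed

lemma ipoly_smult [simp]: "ipoly (Polynomial.smult c p) x = of_int c * ipoly p x"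
proof -
  have "map_poly (of_int :: int \<Rightarrow> complex) (Polynomial.smult c p) = Polynomial.smult (of_int c) (map_poly of_int p)"
    by (rule poly_eqI) (simp add: coeff_map_poly)
  then show ?thesis by (simp add: ipoly_def)
qed

lemma ipoly_uminus [simp]: "ipoly (- p) x = - ipoly p x"
  using ipoly_smult[of "-1" p x] by simp

lemma ipoly_diff [simp]: "ipoly (p - q) x = ipoly p x - ipoly q x"
  using ipoly_add[of p "-q" x] by simp

lemma ipoly_mult [simp]: "ipoly (p * q) x = ipoly p x * ipoly q x"
  by (induction p) (simp_all add: algebra_simps)

lemma ipoly_prod: "ipoly (prod f A) x = (\<Prod>a\<in>A. ipoly (f a) x)"
  by (induction A rule: infinite_finite_induct) auto

lemma ipoly_monom [simp]: "ipoly (Polynomial.monom c n) x = of_int c * x ^ n"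
  by (induction n) (simp_all add: monom_0 monom_Suc)

lemma ipoly_altdef: "ipoly p x = (\<Sum>i\<le>Polynomial.degree p. of_int (Polynomial.coeff p i) * x ^ i)"
proof -
  have "Polynomial.degree (map_poly (of_int :: int \<Rightarrow> complex) p) = Polynomial.degree p"
    by (rule degree_map_poly) auto
  then show ?thesis
    by (simp add: ipoly_def poly_altdef coeff_map_poly)
qed

text \<open>
  Euclid's algorithm against an integer polynomial of least degree vanishing at \<open>x\<close>.
\<close>

lemma ipoly_divides_int:
  assumes "ipoly p0 x = 0" "p0 \<noteq> 0" "ipoly p x \<noteq> 0"
  shows "\<exists>r D. D \<noteq> (0::int) \<and> ipoly r x * ipoly p x = of_int D"
proof -
  let ?deg = "Polynomial.degree :: int poly \<Rightarrow> nat"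
  let ?V = "\<lambda>q. q \<noteq> 0 \<and> ipoly q x = 0"
  define m where "m = arg_min ?deg ?V"
  have "?V m" and min: "\<And>q. ?V q \<Longrightarrow> ?deg m \<le> ?deg q"
    using arg_min_natI[of ?V p0 ?deg] arg_min_nat_le[of ?V _ ?deg] assms(1,2) 
    unfolding m_def by blast+
  then have m: "m \<noteq> 0" "ipoly m x = 0" by auto
  show ?thesis using assms(3)
  proof (induction "?deg p" arbitrary: p rule: less_induct)
    case less
    have "p \<noteq> 0" using less.prems by auto
    show ?case
    proof (cases "?deg p = 0")
      case True
      then obtain c where c: "p = [:c:]" by (metis degree_eq_zeroE)
      then show ?thesis using less.prems by (intro exI[of _ 1] exI[of _ c]) auto
    next
      case pos: False
      show ?thesis
      proof (cases "?deg p < ?deg m")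
        case True
        obtain a q where aq: "a \<noteq> 0" "Polynomial.smult a m = p * q + pseudo_mod m p"
          and s: "pseudo_mod m p = 0 \<or> ?deg (pseudo_mod m p) < ?deg p"
          using pseudo_mod[OF \<open>p \<noteq> 0\<close>, of m] by blast
        define s where "s = pseudo_mod m p"
        have ev: "ipoly p x * ipoly q x + ipoly s x = 0"
          using arg_cong[OF aq(2), of "\<lambda>f. ipoly f x"] m by (simp add: s_def)
        \<comment> \<open>If the remainder vanished at \<open>x\<close>, minimality of
          \<open>m\<close> would make it zero, and the cofactor \<open>q\<close> would vanish at
          \<open>x\<close> with smaller degree than \<open>m\<close>.\<close>
        have "ipoly s x \<noteq> 0"
        proof
          assume s0: "ipoly s x = 0"
          then have "s = 0" using s min[of s] True unfolding s_def by force
          with aq have eq: "Polynomial.smult a m = p * q" by (simp add: s_def)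
          have "q \<noteq> 0" using eq aq(1) m(1) by auto
          have "ipoly q x = 0" using ev s0 less.prems by auto
          moreover have "?deg m = ?deg p + ?deg q"
            using arg_cong[OF eq, of ?deg] \<open>p \<noteq> 0\<close> \<open>q \<noteq> 0\<close> aq(1) by (simp add: degree_mult_eq)
          ultimately show False using min[of q] \<open>q \<noteq> 0\<close> pos by auto
        qed
        moreover from this have "?deg s < ?deg p" using s by (auto simp: s_def)
        ultimately obtain r D where rD: "D \<noteq> 0" "ipoly r x * ipoly s x = of_int D"
          using less.hyps[of s] by blast
        have "ipoly s x = - (ipoly p x * ipoly q x)" using ev by (simp add: eq_neg_iff_add_eq_0 add.commute)
        then have "ipoly (- (r * q)) x * ipoly p x = of_int D"
          using rD(2) by (simp add: algebra_simps)
        then show ?thesis using rD(1) by blast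
      next
        case False
        obtain a q where aq: "a \<noteq> 0" "Polynomial.smult a p = m * q + pseudo_mod p m"
          and s: "pseudo_mod p m = 0 \<or> ?deg (pseudo_mod p m) < ?deg m"
          using pseudo_mod[OF m(1), of p] by blast
        define s where "s = pseudo_mod p m"
        have ev: "of_int a * ipoly p x = ipoly s x"
          using arg_cong[OF aq(2), of "\<lambda>f. ipoly f x"] m by (simp add: s_def)
        then have "ipoly s x \<noteq> 0" using less.prems aq(1) by (metis mult_eq_0_iff of_int_eq_0_iff)
        moreover from this have "?deg s < ?deg p" using s False by (auto simp: s_def)
        ultimately obtain r D where rD: "D \<noteq> 0" "ipoly r x * ipoly s x = of_int D"
          using less.hyps[of s] by blast
        have "ipoly (Polynomial.smult a r) x * ipoly p x = of_int D"
          using rD(2) by (simp add: mult.left_commute mult.assoc flip: ev)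
        then show ?thesis using rD(1) by blast
      qed
    qed
  qed
qed

locale cyclotomic =
  fixes N :: nat
  assumes N_pos: "0 < N"
begin

definition \<zeta> :: complex where "\<zeta> = cis (2 * pi / N)"

definition R :: "complex set" where "R = range (\<lambda>p. ipoly p \<zeta>)"

text \<open>
  The conjugates of \<open>\<zeta>\<close>, described by the polynomials they annihilate; this makes the irreducibility
  of cyclotomic polynomials unnecessary. The map \<open>\<sigma> w\<close> is meaningful only on \<open>R\<close> and for \<open>w \<in> \<Omega>\<close>.
\<close>

definition \<Omega> :: "complex set" where
  "\<Omega> = {w. w ^ N = 1 \<and> (\<forall>p. ipoly p w = 0 \<longleftrightarrow> ipoly p \<zeta> = 0)}"

definition \<sigma> :: "complex \<Rightarrow> complex \<Rightarrow> complex" where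
  "\<sigma> w x = ipoly (SOME p. ipoly p \<zeta> = x) w"

lemma zeta_power_N [simp]: "\<zeta> ^ N = 1"
  using N_pos by (simp add: \<zeta>_def Complex.DeMoivre)

lemma zeta_nonzero [simp]: "\<zeta> \<noteq> 0"
  by (simp add: \<zeta>_def)

lemma roots_eq_zeta_power: "{w. w ^ N = 1} = (\<lambda>k. \<zeta> ^ k) ` {..<N}"
proof -
  have "\<zeta> ^ k = cis (2 * pi * real k / real N)" for k
    by (simp add: \<zeta>_def Complex.DeMoivre mult_ac)
  then show ?thesis using Complex.bij_betw_roots_unity[OF N_pos] by (simp add: bij_betw_def)
qed

lemma inj_zeta_power: "inj_on (\<lambda>k. \<zeta> ^ k) {..<N}"
proof -
  have "\<zeta> ^ k = cis (2 * pi * real k / real N)" for k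
    by (simp add: \<zeta>_def Complex.DeMoivre mult_ac)
  then show ?thesis using Complex.bij_betw_roots_unity[OF N_pos] by (simp add: bij_betw_def)
qed

lemma finite_roots: "finite {w::complex. w ^ N = 1}"
  by (simp add: roots_eq_zeta_power)

text \<open>The choice of polynomial does not matter: two polynomials agreeing at
  \<open>\<zeta>\<close> differ by one that vanishes at \<open>\<zeta>\<close>, hence at
  \<open>w\<close>.\<close>

lemma sigma_ipoly: "w \<in> \<Omega> \<Longrightarrow> \<sigma> w (ipoly p \<zeta>) = ipoly p w"
proof -
  assume w: "w \<in> \<Omega>"
  define q where "q = (SOME q. ipoly q \<zeta> = ipoly p \<zeta>)"
  have "ipoly q \<zeta> = ipoly p \<zeta>" unfolding q_def by (rule someI) simp
  then have "ipoly (q - p) \<zeta> = 0" by simp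
  then have "ipoly (q - p) w = 0" using w unfolding \<Omega>_def by blast
  then show ?thesis by (simp add: \<sigma>_def q_def)
qed

lemma R_cases: "x \<in> R \<Longrightarrow> (\<And>p. x = ipoly p \<zeta> \<Longrightarrow> P) \<Longrightarrow> P"
  by (auto simp: R_def)

lemma ipoly_in_R [simp]: "ipoly p \<zeta> \<in> R"
  by (auto simp: R_def)

lemma R_of_int [simp]: "of_int c \<in> R" using ipoly_in_R[of "[:c:]"] by simp
lemma R_1 [simp]: "1 \<in> R" using R_of_int[of 1] by simp
lemma R_add [simp]: "x \<in> R \<Longrightarrow> y \<in> R \<Longrightarrow> x + y \<in> R"
  by (elim R_cases, simp flip: ipoly_add)
lemma R_diff [simp]: "x \<in> R \<Longrightarrow> y \<in> R \<Longrightarrow> x - y \<in> R"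
  by (elim R_cases, simp flip: ipoly_diff)
lemma R_mult [simp]: "x \<in> R \<Longrightarrow> y \<in> R \<Longrightarrow> x * y \<in> R"
  by (elim R_cases, simp flip: ipoly_mult)
lemma R_root: "u ^ N = 1 \<Longrightarrow> u \<in> R"
proof -
  assume "u ^ N = 1"
  then obtain k where "u = \<zeta> ^ k" using roots_eq_zeta_power by blast
  then show "u \<in> R" using ipoly_in_R[of "Polynomial.monom 1 k"] by simp
qed

context
  fixes w assumes w: "w \<in> \<Omega>"
begin

lemma sigma_of_int [simp]: "\<sigma> w (of_int c) = of_int c"
  using sigma_ipoly[OF w, of "[:c:]"] by simp
lemma sigma_1 [simp]: "\<sigma> w 1 = 1"
  using sigma_of_int[of 1] by simp
lemma sigma_add [simp]: "x \<in> R \<Longrightarrow> y \<in> R \<Longrightarrow> \<sigma> w (x + y) = \<sigma> w x + \<sigma> w y"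
  by (elim R_cases) (metis sigma_ipoly[OF w] ipoly_add)
lemma sigma_diff [simp]: "x \<in> R \<Longrightarrow> y \<in> R \<Longrightarrow> \<sigma> w (x - y) = \<sigma> w x - \<sigma> w y"
  by (elim R_cases) (metis sigma_ipoly[OF w] ipoly_diff)
lemma sigma_mult [simp]: "x \<in> R \<Longrightarrow> y \<in> R \<Longrightarrow> \<sigma> w (x * y) = \<sigma> w x * \<sigma> w y"
  by (elim R_cases) (metis sigma_ipoly[OF w] ipoly_mult)
lemma sigma_eq_0_iff: "x \<in> R \<Longrightarrow> \<sigma> w x = 0 \<longleftrightarrow> x = 0"
  using w by (elim R_cases) (simp add: sigma_ipoly \<Omega>_def)
lemma sigma_power [simp]: "x \<in> R \<Longrightarrow> x ^ n \<in> R \<and> \<sigma> w (x ^ n) = \<sigma> w x ^ n"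
  by (induction n) auto

end

text \<open>Exponents are folded modulo \<open>N\<close>. One coefficient function serves all
  \<open>N\<close>-th roots of unity at once, as Fourier inversion requires.\<close>

lemma reduce_ipoly:
  obtains c :: "nat \<Rightarrow> int" where "\<And>w. w ^ N = 1 \<Longrightarrow> ipoly p w = (\<Sum>j<N. of_int (c j) * w ^ j)"
proof
  fix w :: complex assume w: "w ^ N = 1"
  have pow: "w ^ i = w ^ (i mod N)" for i
    by (metis w div_mult_mod_eq mult.commute mult_1 power_add power_mult power_one)
  let ?d = "Polynomial.degree p" and ?c = "Polynomial.coeff p"
  have "ipoly p w = (\<Sum>i\<le>?d. of_int (?c i) * w ^ i)" by (rule ipoly_altdef)
  also have "\<dots> = (\<Sum>j<N. \<Sum>i\<in>{i \<in> {..?d}. i mod N = j}. of_int (?c i) * w ^ i)"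
    by (rule sum.group[symmetric]) (use N_pos in auto)
  also have "\<dots> = (\<Sum>j<N. of_int (\<Sum>i\<in>{i \<in> {..?d}. i mod N = j}. ?c i) * w ^ j)"
    unfolding of_int_sum sum_distrib_right
    by (intro sum.cong refl) (metis (mono_tags, lifting) mem_Collect_eq pow)
  finally show "ipoly p w = (\<Sum>j<N. of_int (\<Sum>i\<in>{i \<in> {..?d}. i mod N = j}. ?c i) * w ^ j)" .
qed

text \<open>Orthogonality of characters of a cyclic group: the powers of \<open>u j\<close> over a
  full period sum to zero unless \<open>j = i\<close>.\<close>

lemma fourier_coefficient:
  assumes "i < N"
  shows "(\<Sum>k<N. (\<Sum>j<N. c j * (\<zeta> ^ k) ^ j) * inverse (\<zeta> ^ k) ^ i) = of_nat N * c i"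
proof -
  define u where "u j = \<zeta> ^ j * inverse (\<zeta> ^ i)" for j
  have geo: "(\<Sum>k<N. u j ^ k) = (if j = i then of_nat N else 0)" if "j < N" for j
  proof (cases "j = i")
    case True
    then show ?thesis by (simp add: u_def)
  next
    case False
    then have "\<zeta> ^ j \<noteq> \<zeta> ^ i" using inj_zeta_power assms that by (auto simp: inj_on_def)
    then have "u j \<noteq> 1" by (auto simp: u_def field_simps)
    moreover have "u j ^ N = 1"
      by (simp add: u_def power_mult_distrib power_inverse flip: power_mult)
         (simp add: mult.commute power_mult)
    ultimately show ?thesis using False geometric_sum[of "u j" N] by simp
  qed
  have "(\<Sum>k<N. (\<Sum>j<N. c j * (\<zeta> ^ k) ^ j) * inverse (\<zeta> ^ k) ^ i) = (\<Sum>k<N. \<Sum>j<N. c j * u j ^ k)"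
    unfolding sum_distrib_right
    by (intro sum.cong refl) (simp add: u_def power_mult_distrib power_inverse mult.commute flip: power_mult)
  also have "\<dots> = (\<Sum>j<N. c j * (\<Sum>k<N. u j ^ k))"
    by (subst sum.swap) (simp add: sum_distrib_left)
  also have "\<dots> = (\<Sum>j<N. if j = i then of_nat N * c i else 0)"
    by (intro sum.cong refl) (auto simp: geo)
  finally show ?thesis using assms by simp
qed

text \<open>Only a \<open>p\<close> vanishing at \<open>\<zeta>\<close> but not at \<open>w\<close>
  needs work: some multiple \<open>r * p\<close> takes a nonzero integer value \<open>D\<close> at
  \<open>w\<close>, and \<open>D - r * p\<close> is then zero at \<open>w\<close> and
  \<open>D\<close> at \<open>\<zeta>\<close>.\<close>

lemma ex_separating_ipoly:
  assumes "w ^ N = 1" "w \<notin> \<Omega>"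
  shows "\<exists>q. ipoly q w = 0 \<and> ipoly q \<zeta> \<noteq> 0"
proof (rule ccontr)
  assume no: "\<not> ?thesis"
  with assms obtain p where p: "ipoly p w \<noteq> 0" "ipoly p \<zeta> = 0"
    unfolding \<Omega>_def by blast
  let ?X = "Polynomial.monom 1 N - 1 :: int poly"
  have "ipoly ?X w = 0" using assms by simp
  moreover have "ipoly ?X 0 = -1" using N_pos by simp
  then have "?X \<noteq> 0" by (metis ipoly_0 zero_neq_neg_one)
  ultimately obtain r D where rD: "D \<noteq> 0" "ipoly r w * ipoly p w = of_int D"
    using ipoly_divides_int p(1) by blast
  have "ipoly ([:D:] - r * p) w = 0" "ipoly ([:D:] - r * p) \<zeta> \<noteq> 0"
    using rD p by auto
  with no show False by blast
qed

text \<open>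
  Multiplying by a polynomial \<open>Q\<close> that vanishes at the non-conjugate \<open>N\<close>-th roots of unity but not at \<open>\<zeta>\<close>
  bounds the values at all \<open>N\<close>-th roots of unity, and then Fourier inversion bounds the integer
  coefficients.
\<close>

lemma finite_bounded_conjugates:
  "finite {x \<in> R. \<forall>w\<in>\<Omega>. cmod (\<sigma> w x) \<le> f w}" (is "finite ?A")
proof -
  let ?U = "{w::complex. w ^ N = 1}"
  have fin: "finite ?U" by (rule finite_roots)
  have "\<forall>w\<in>?U - \<Omega>. \<exists>q. ipoly q w = 0 \<and> ipoly q \<zeta> \<noteq> 0"
    using ex_separating_ipoly by blast
  then obtain q where q: "\<forall>w\<in>?U - \<Omega>. ipoly (q w) w = 0 \<and> ipoly (q w) \<zeta> \<noteq> 0"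
    by (rule bchoice[THEN exE])
  define Q where "Q = prod q (?U - \<Omega>)"
  have Q\<zeta>: "ipoly Q \<zeta> \<noteq> 0" unfolding Q_def ipoly_prod
    by (subst prod_zero_iff) (use q fin in blast)+
  have Q0: "ipoly Q w = 0" if "w \<in> ?U - \<Omega>" for w
    unfolding Q_def ipoly_prod
    by (rule prod_zero) (use q fin that in blast)+
  have \<Omega>U: "\<Omega> \<subseteq> ?U" by (auto simp: \<Omega>_def)
  then have fin\<Omega>: "finite \<Omega>" using fin finite_subset by blast
  \<comment> \<open>Since \<open>f\<close> is arbitrary, absolute values keep the summands
    nonnegative, so each is at most the sum.\<close>
  define B where "B = (\<Sum>w\<in>\<Omega>. \<bar>f w * cmod (ipoly Q w)\<bar>)"
  define Cs where "Cs = {..<N} \<rightarrow>\<^sub>E {- \<lceil>B\<rceil>..\<lceil>B\<rceil>}"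
  have "?A \<subseteq> (\<lambda>c. (\<Sum>j<N. of_int (c j) * \<zeta> ^ j) / ipoly Q \<zeta>) ` Cs"
  proof
    fix x assume x: "x \<in> ?A"
    then obtain p where p: "x = ipoly p \<zeta>" by (auto simp: R_def)
    have bound: "cmod (ipoly (p * Q) w) \<le> B" if "w ^ N = 1" for w
    proof (cases "w \<in> \<Omega>")
      case True
      have "cmod (\<sigma> w x) \<le> f w" using x True by blast
      then have "cmod (ipoly p w) \<le> f w" by (simp only: p sigma_ipoly[OF True])
      then have "cmod (ipoly (p * Q) w) \<le> \<bar>f w * cmod (ipoly Q w)\<bar>"
        by (simp add: norm_mult abs_mult mult_right_mono)
      also have "\<dots> \<le> B" unfolding B_def using True fin\<Omega> by (intro member_le_sum) auto
      finally show ?thesis .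
    next
      case False
      have "0 \<le> B" by (simp add: B_def sum_nonneg)
      then show ?thesis using Q0[of w] that False by simp
    qed
    obtain c where c: "\<And>w. w ^ N = 1 \<Longrightarrow> ipoly (p * Q) w = (\<Sum>j<N. of_int (c j) * w ^ j)"
      using reduce_ipoly[of "p * Q"] by blast
    have root: "(\<zeta> ^ k) ^ N = 1" for k
    proof -
      have "(\<zeta> ^ k) ^ N = (\<zeta> ^ N) ^ k" by (simp only: mult.commute flip: power_mult)
      then show ?thesis by simp
    qed
    have *: "\<bar>real_of_int (c i)\<bar> \<le> B" if "i < N" for i
    proof -
      have "of_nat N * (of_int (c i) :: complex)
          = (\<Sum>k<N. ipoly (p * Q) (\<zeta> ^ k) * inverse (\<zeta> ^ k) ^ i)"
        using fourier_coefficient[OF that, of "\<lambda>j. of_int (c j)"] by (simp only: c[OF root])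
      then have "real N * \<bar>real_of_int (c i)\<bar>
          = cmod (\<Sum>k<N. ipoly (p * Q) (\<zeta> ^ k) * inverse (\<zeta> ^ k) ^ i)"
        by (subst (asm) (1) eq_commute) (simp add: norm_mult)
      also have "\<dots> \<le> (\<Sum>k<N. B)"
      proof (rule sum_norm_le)
        fix k
        have "cmod (inverse (\<zeta> ^ k) ^ i) = 1"
          by (simp add: \<zeta>_def norm_power norm_inverse)
        then show "cmod (ipoly (p * Q) (\<zeta> ^ k) * inverse (\<zeta> ^ k) ^ i) \<le> B"
          using bound[OF root] by (simp only: norm_mult mult_1_right)
      qed
      finally show ?thesis using N_pos by simp
    qed
    have bound_int: "- \<lceil>B\<rceil> \<le> c i \<and> c i \<le> \<lceil>B\<rceil>" if "i < N" for i
    proof -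
      have "real_of_int (c i) \<le> of_int \<lceil>B\<rceil>" "real_of_int (- c i) \<le> of_int \<lceil>B\<rceil>"
        using that[THEN *] le_of_int_ceiling[of B] by linarith+
      then have "c i \<le> \<lceil>B\<rceil>" "- c i \<le> \<lceil>B\<rceil>" by (simp_all only: of_int_le_iff)
      then show ?thesis by linarith
    qed
    \<comment> \<open>The function \<open>c\<close> is unconstrained from \<open>N\<close> on;
      cutting it off places it in the finite set of extensional functions.\<close>
    have "restrict c {..<N} \<in> Cs"
      unfolding Cs_def using bound_int by (auto simp: restrict_def)
    moreover have "x = (\<Sum>j<N. of_int (restrict c {..<N} j) * \<zeta> ^ j) / ipoly Q \<zeta>"
      using c[OF zeta_power_N] Q\<zeta> by (simp add: p eq_divide_eq)
    ultimately show "x \<in> (\<lambda>c. (\<Sum>j<N. of_int (c j) * \<zeta> ^ j) / ipoly Q \<zeta>) ` Cs" by blast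
  qed
  moreover have "finite Cs" unfolding Cs_def by (intro finite_PiE) auto
  ultimately show ?thesis using finite_surj by blast
qed

end

subsection \<open>Two by two matrices\<close>

text \<open>A separate type whose \<open>*\<close> is the matrix product, so that powers and ring
  simplification apply directly; \<open>to_m2\<close> carries \<open>GL2\<close> into it.\<close>

datatype m2 = M2 (m11: complex) (m12: complex) (m21: complex) (m22: complex)

lemma m2_eq_iff: "M = Y \<longleftrightarrow> m11 M = m11 Y \<and> m12 M = m12 Y \<and> m21 M = m21 Y \<and> m22 M = m22 Y"
  by (cases M; cases Y) simp

instantiation m2 :: ring_1
begin

definition "0 = M2 0 0 0 0"
definition "1 = M2 1 0 0 1"
definition "M + Y = M2 (m11 M + m11 Y) (m12 M + m12 Y) (m21 M + m21 Y) (m22 M + m22 Y)"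
definition "M - Y = M2 (m11 M - m11 Y) (m12 M - m12 Y) (m21 M - m21 Y) (m22 M - m22 Y)"
definition "- M = M2 (- m11 M) (- m12 M) (- m21 M) (- m22 M)"
definition "M * Y = M2 (m11 M * m11 Y + m12 M * m21 Y) (m11 M * m12 Y + m12 M * m22 Y)
                       (m21 M * m11 Y + m22 M * m21 Y) (m21 M * m12 Y + m22 M * m22 Y)"

lemmas m2_ops = zero_m2_def one_m2_def plus_m2_def minus_m2_def uminus_m2_def times_m2_def

instance
  by standard (simp_all add: m2_ops m2_eq_iff algebra_simps)

end

definition sc :: "complex \<Rightarrow> m2" where "sc c = M2 c 0 0 c"
definition tr :: "m2 \<Rightarrow> complex" where "tr M = m11 M + m22 M"
definition dt :: "m2 \<Rightarrow> complex" where "dt M = m11 M * m22 M - m12 M * m21 M"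
text \<open>The adjugate is polynomial in the entries and is the inverse as soon as
  \<open>dt M = 1\<close>.\<close>

definition adj :: "m2 \<Rightarrow> m2" where "adj M = M2 (m22 M) (- m12 M) (- m21 M) (m11 M)"

lemmas m2_defs = m2_ops sc_def tr_def dt_def adj_def

lemma sc_0 [simp]: "sc 0 = 0" and sc_1 [simp]: "sc 1 = 1"
  and sc_add: "sc (c + d) = sc c + sc d"
  and sc_diff: "sc (c - d) = sc c - sc d"
  and sc_uminus: "sc (- c) = - sc c"
  and sc_mult: "sc (c * d) = sc c * sc d"
  by (simp_all add: m2_defs)

lemma sc_power: "sc (c ^ n) = sc c ^ n"
  by (induction n) (simp_all add: sc_mult)

lemma sc_of_nat: "sc (of_nat n) = of_nat n"
  by (induction n) (simp_all add: sc_add)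

lemma sc_commute: "M * sc c = sc c * M"
  by (simp add: m2_defs mult.commute)

lemma sc_left_commute: "M * (sc c * Y) = sc c * (M * Y)"
  by (simp add: sc_commute flip: mult.assoc)

lemma sc_mult_mult: "(sc c * M) * (sc d * Y) = sc (c * d) * (M * Y)"
  by (simp add: m2_defs algebra_simps)

lemma sc_mult_eq_0_iff: "sc c * M = 0 \<longleftrightarrow> c = 0 \<or> M = 0"
  by (auto simp: m2_defs m2_eq_iff)

lemma dt_1 [simp]: "dt 1 = 1"
  by (simp add: m2_defs)

lemma dt_mult: "dt (M * Y) = dt M * dt Y"
  by (simp add: m2_defs algebra_simps)

lemma dt_power: "dt (M ^ n) = dt M ^ n"
  by (induction n) (simp_all add: dt_mult)

lemma dt_sc: "dt (sc c) = c ^ 2"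
  by (simp add: m2_defs power2_eq_square)

lemma adj_mult_self: "adj M * M = sc (dt M)"
  by (simp add: m2_defs mult.commute)

lemma dt_adj [simp]: "dt (adj M) = dt M"
  by (simp add: m2_defs)

text \<open>The Cayley-Hamilton equation, which eliminates squares of generators.\<close>

lemma square_eq: "M * M = sc (tr M) * M - sc (dt M)"
  by (simp add: m2_defs algebra_simps)

text \<open>This polarisation of \<open>square_eq\<close> reverses a product at the cost of
  coefficients that are polynomials in traces.\<close>

lemma swap_eq:
  "Y * M = sc (tr M) * Y + sc (tr Y) * M + sc (tr (M * Y) - tr M * tr Y) - M * Y"
  by (simp add: m2_defs algebra_simps)

lemma tr_mult_adj: "tr (M * adj Y) = tr M * tr Y - tr (M * Y)"
  by (simp add: m2_defs algebra_simps)

text \<open>Fricke's trace identity, made homogeneous by the determinants.\<close>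

lemma tr_commutator:
  "tr (A * B * adj A * adj B) =
    tr A ^ 2 * dt B + tr B ^ 2 * dt A + tr (A * B) ^ 2 - tr A * tr B * tr (A * B) - 2 * dt A * dt B"
  by (simp add: m2_defs algebra_simps power2_eq_square)

section \<open>The determinant as a quaternary form in the basis
  \<open>1, A, B, A * B\<close>\<close>

definition comb :: "m2 \<Rightarrow> m2 \<Rightarrow> complex \<Rightarrow> complex \<Rightarrow> complex \<Rightarrow> complex \<Rightarrow> m2" where
  "comb A B x y z w = sc x + sc y * A + sc z * B + sc w * (A * B)"

text \<open>Here \<open>a\<close>, \<open>b\<close>, \<open>c\<close> stand for the traces of
  \<open>A\<close>, \<open>B\<close>, \<open>A * B\<close>. The polymorphic type lets one form serve
  for complex traces and for their real conjugates.\<close>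

definition norm_form :: "'a::comm_ring_1 \<Rightarrow> 'a \<Rightarrow> 'a \<Rightarrow> 'a \<Rightarrow> 'a \<Rightarrow> 'a \<Rightarrow> 'a \<Rightarrow> 'a" where
  "norm_form a b c x y z w = x * x + y * y + z * z + w * w
     + a * x * y + b * x * z + c * x * w + (a * b - c) * y * z + b * y * w + a * z * w"

text \<open>For determinants \<open>1\<close> this is \<open>2\<close> minus the trace of the
  commutator, by \<open>tr_commutator\<close>.\<close>

definition disc :: "'a::comm_ring_1 \<Rightarrow> 'a \<Rightarrow> 'a \<Rightarrow> 'a" where
  "disc a b c = 4 - a * a - b * b - c * c + a * b * c"

text \<open>
  Identities that hold for determinants equal to \<open>1\<close> are first homogenised by inserting \<open>dt A\<close> and \<open>dt B\<close>,
  so that they become polynomial identities in the entries.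
\<close>

lemma dt_comb_homogeneous:
  "dt (comb A B x y z w) = x * x + dt A * (y * y) + dt B * (z * z) + dt A * dt B * (w * w)
     + tr A * x * y + tr B * x * z + tr (A * B) * x * w + (tr A * tr B - tr (A * B)) * y * z
     + dt A * tr B * y * w + dt B * tr A * z * w"
  by (cases A; cases B) (simp add: comb_def m2_defs algebra_simps)

lemma dt_comb:
  assumes "dt A = 1" "dt B = 1"
  shows "dt (comb A B x y z w) = norm_form (tr A) (tr B) (tr (A * B)) x y z w"
  using dt_comb_homogeneous[of A B x y z w] assms by (simp add: norm_form_def)

text \<open>
  The coefficients form the inverse, scaled by the discriminant, of the Gram matrix of
  \<open>1, A, B, A B\<close> under \<open>(X, Y) \<mapsto> tr (X adj Y)\<close>.
\<close>

lemma dual_basis_homogeneous: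
  fixes A B C :: m2
  defines "a \<equiv> tr A" and "b \<equiv> tr B" and "c \<equiv> tr (A * B)" and "\<alpha> \<equiv> dt A" and "\<beta> \<equiv> dt B"
    and "f0 \<equiv> tr C" and "f1 \<equiv> tr (C * adj A)" and "f2 \<equiv> tr (C * adj B)" and "f3 \<equiv> tr (C * adj (A * B))"
  shows "sc (4 * \<alpha> * \<beta> - a * a * \<beta> - b * b * \<alpha> - c * c + a * b * c) * C = comb A B
     (2 * \<alpha> * \<beta> * f0 - a * \<beta> * f1 - b * \<alpha> * f2 + (a * b - c) * f3)
     (- a * \<beta> * f0 + 2 * \<beta> * f1 + c * f2 - b * f3)
     (- b * \<alpha> * f0 + c * f1 + 2 * \<alpha> * f2 - a * f3)
     ((a * b - c) * f0 - b * f1 - a * f2 + 2 * f3)"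
  unfolding assms m2_eq_iff comb_def m2_defs m2.sel
  by (intro conjI; simp add: algebra_simps)

text \<open>Completion of the square in \<open>x\<close> and \<open>y\<close> together: the two
  linear forms are the partial derivatives of \<open>norm_form\<close> in these variables.\<close>

lemma norm_form_completed_square:
  fixes a b c x y z w :: "'a::comm_ring_1"
  shows "(4 - a * a) * norm_form a b c x y z w =
     (2 * x + a * y + b * z + c * w) * (2 * x + a * y + b * z + c * w)
     - a * (2 * x + a * y + b * z + c * w) * (a * x + 2 * y + (a * b - c) * z + b * w)
     + (a * x + 2 * y + (a * b - c) * z + b * w) * (a * x + 2 * y + (a * b - c) * z + b * w)
     + disc a b c * (z * z + a * z * w + w * w)"
  unfolding norm_form_def disc_def by (simp add: algebra_simps)

text \<open>Multiplying \<open>(x + y A) + (z + w A) B\<close> on the right by the inverse of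
  \<open>B\<close> exchanges the two pairs and replaces \<open>B\<close> by its inverse, so that
  \<open>tr (A B)\<close> becomes \<open>a * b - c\<close>. Bounds on \<open>z\<close>,
  \<open>w\<close> thus carry over to \<open>x\<close>, \<open>y\<close>.\<close>

lemma norm_form_swap: "norm_form a b c x y z w = norm_form a b (a * b - c) z w x y"
  unfolding norm_form_def by (simp add: algebra_simps)

lemma disc_swap: "disc a b (a * b - c) = disc a b c"
  unfolding disc_def by (simp add: algebra_simps)

lemma binary_form_bounds:
  fixes a z w :: real
  shows "(4 - a * a) * (w * w) \<le> 4 * (z * z + a * z * w + w * w)"
    and "(4 - a * a) * (z * z) \<le> 4 * (z * z + a * z * w + w * w)"
proof -
  have "4 * (z * z + a * z * w + w * w) - (4 - a * a) * (w * w) = (2 * z + a * w) * (2 * z + a * w)"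
    and "4 * (z * z + a * z * w + w * w) - (4 - a * a) * (z * z) = (2 * w + a * z) * (2 * w + a * z)"
    by (simp_all add: algebra_simps)
  then show "(4 - a * a) * (w * w) \<le> 4 * (z * z + a * z * w + w * w)"
    and "(4 - a * a) * (z * z) \<le> 4 * (z * z + a * z * w + w * w)"
    by (metis diff_ge_0_iff_ge zero_le_square)+
qed

lemma norm_form_bounds_zw:
  fixes a b c x y z w :: real
  assumes disc: "disc a b c > 0" and a: "\<bar>a\<bar> \<le> 2"
  shows "disc a b c * (z * z) \<le> 4 * norm_form a b c x y z w"
    and "disc a b c * (w * w) \<le> 4 * norm_form a b c x y z w"
proof -
  \<comment> \<open>At \<open>a = 2\<close> and \<open>a = -2\<close> the discriminant is minus a
    square, against its positivity.\<close>
  have "a * a \<noteq> 4"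
  proof
    assume "a * a = 4"
    then have "(a - 2) * (a + 2) = 0" by (simp add: algebra_simps)
    then consider "a = 2" | "a = -2" by auto
    then show False
    proof cases
      case 1
      then have "disc a b c = - ((b - c) * (b - c))" unfolding disc_def by (simp add: algebra_simps)
      then show False using disc zero_le_square[of "b - c"] by linarith
    next
      case 2
      then have "disc a b c = - ((b + c) * (b + c))" unfolding disc_def by (simp add: algebra_simps)
      then show False using disc zero_le_square[of "b + c"] by linarith
    qed
  qed
  moreover have "a * a \<le> 4" using a abs_le_square_iff[of a 2] by (simp add: power2_eq_square)
  ultimately have pos: "0 < 4 - a * a" by linarith
  define P where "P = 2 * x + a * y + b * z + c * w"
  define Q where "Q = a * x + 2 * y + (a * b - c) * z + b * w"
  define q where "q = z * z + a * z * w + w * w"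
  have "0 \<le> (4 - a * a) * (Q * Q)" using pos by simp
  also have "\<dots> \<le> 4 * (P * P + (- a) * P * Q + Q * Q)"
    using binary_form_bounds(1)[of "-a" Q P] by simp
  finally have "0 \<le> P * P - a * P * Q + Q * Q" by simp
  then have "disc a b c * q \<le> (4 - a * a) * norm_form a b c x y z w"
    unfolding norm_form_completed_square by (simp add: P_def Q_def q_def)
  then have le: "4 * disc a b c * q \<le> (4 - a * a) * (4 * norm_form a b c x y z w)" by simp
  have "(4 - a * a) * (disc a b c * (w * w)) \<le> 4 * disc a b c * q"
    using mult_left_mono[OF binary_form_bounds(1)[of a w z], of "disc a b c"] disc
    by (simp add: q_def algebra_simps)
  with le have "(4 - a * a) * (disc a b c * (w * w)) \<le> (4 - a * a) * (4 * norm_form a b c x y z w)"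
    by linarith
  with pos show "disc a b c * (w * w) \<le> 4 * norm_form a b c x y z w" by simp
  have "(4 - a * a) * (disc a b c * (z * z)) \<le> 4 * disc a b c * q"
    using mult_left_mono[OF binary_form_bounds(2)[of a z w], of "disc a b c"] disc
    by (simp add: q_def algebra_simps)
  with le have "(4 - a * a) * (disc a b c * (z * z)) \<le> (4 - a * a) * (4 * norm_form a b c x y z w)"
    by linarith
  with pos show "disc a b c * (z * z) \<le> 4 * norm_form a b c x y z w" by simp
qed

lemma norm_form_bounds:
  fixes a b c x y z w :: real
  assumes "disc a b c > 0" "\<bar>a\<bar> \<le> 2" "t \<in> {x, y, z, w}"
  shows "disc a b c * (t * t) \<le> 4 * norm_form a b c x y z w"
proof -
  have "disc a b c * (z * z) \<le> 4 * norm_form a b c x y z w"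
    "disc a b c * (w * w) \<le> 4 * norm_form a b c x y z w"
    using norm_form_bounds_zw assms(1,2) by blast+
  moreover have "disc a b c * (x * x) \<le> 4 * norm_form a b c x y z w"
    "disc a b c * (y * y) \<le> 4 * norm_form a b c x y z w"
    using norm_form_bounds_zw[where a = a and b = b and c = "a * b - c" and x = z and y = w and z = x and w = y] assms(1,2)
    unfolding disc_swap norm_form_swap[of a b c x y z w] by blast+
  ultimately show ?thesis using assms(3) by blast
qed

text \<open>For a root \<open>u\<close> of the characteristic polynomial, Cayley-Hamilton gives
  \<open>M * Y = u * Y\<close> with \<open>Y = M - inverse u\<close>, hence
  \<open>u ^ n * Y = Y\<close>. Either \<open>u ^ n = 1\<close> follows, or \<open>Y = 0\<close> and
  \<open>M\<close> is the scalar \<open>inverse u\<close>.\<close>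

lemma torsion_trace:
  assumes "M ^ n = 1" "dt M = 1"
  obtains u where "u ^ n = 1" "tr M = u + inverse u"
proof -
  obtain u where u: "u * u - tr M * u + 1 = 0"
  proof -
    define s where "s = csqrt (tr M ^ 2 - 4)"
    have "s * s = tr M * tr M - 4"
      using power2_csqrt[of "tr M ^ 2 - 4"] by (simp add: s_def power2_eq_square)
    moreover have "(tr M + s) / 2 * ((tr M + s) / 2) - tr M * ((tr M + s) / 2) + 1
        = (s * s - (tr M * tr M - 4)) / 4"
      by (simp add: field_simps)
    ultimately show ?thesis by (intro that[of "(tr M + s) / 2"]) simp
  qed
  then have "u \<noteq> 0" by auto
  then have "(u + inverse u) * u = u * u + 1" by (simp add: distrib_right)
  also have "\<dots> = tr M * u" using u by (simp add: algebra_simps)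
  finally have trX: "tr M = u + inverse u" using \<open>u \<noteq> 0\<close> by simp
  let ?Y = "M - sc (inverse u)"
  have "M * ?Y = sc u * ?Y"
  proof -
    have "M * ?Y = sc (u + inverse u) * M - 1 - sc (inverse u) * M"
      by (simp add: right_diff_distrib square_eq assms(2) sc_commute flip: trX)
    also have "\<dots> = sc u * M - sc (u * inverse u)"
      using \<open>u \<noteq> 0\<close> by (simp add: sc_add algebra_simps)
    finally show ?thesis by (simp add: right_diff_distrib sc_mult)
  qed
  then have step: "M * ?Y = sc u * ?Y" .
  have "M ^ k * ?Y = sc (u ^ k) * ?Y" for k
  proof (induction k)
    case (Suc k)
    have "M ^ Suc k * ?Y = M ^ k * (sc u * ?Y)"
      by (simp only: power_Suc2 mult.assoc step)
    also have "\<dots> = sc u * (M ^ k * ?Y)" by (rule sc_left_commute)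
    also have "\<dots> = sc (u ^ Suc k) * ?Y"
      by (simp only: Suc power_Suc sc_mult mult.assoc)
    finally show ?case .
  qed simp
  from this[of n] have "sc (u ^ n - 1) * ?Y = 0"
    using assms(1) by (simp add: sc_diff left_diff_distrib)
  then consider "u ^ n = 1" | "M = sc (inverse u)"
    by (auto simp: sc_mult_eq_0_iff)
  then have "u ^ n = 1"
  proof cases
    case 2
    then have "sc (inverse u ^ n) = sc 1" using assms(1) by (simp add: sc_power)
    then have "inverse u ^ n = 1" by (simp add: sc_def one_m2_def)
    then show ?thesis by (simp add: power_inverse)
  qed
  with trX that show ?thesis by blast
qed

text \<open>By Cayley-Hamilton \<open>Y = M - 1\<close> squares to zero, so
  \<open>M ^ n = 1 + n * Y\<close>, which forces \<open>Y = 0\<close> in characteristic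
  zero.\<close>

lemma torsion_trace_2:
  assumes "M ^ n = 1" "n > 0" "dt M = 1" "tr M = 2"
  shows "M = 1"
proof -
  define Y where "Y = M - 1"
  have "sc 2 = 1 + 1" by (simp add: m2_defs)
  then have YY: "Y * Y = 0"
    using square_eq[of M] assms(3,4) by (simp add: Y_def algebra_simps mult_2)
  have "M ^ k = 1 + of_nat k * Y" for k
  proof (induction k)
    case (Suc k)
    have "M ^ Suc k = (1 + of_nat k * Y) * (1 + Y)"
      by (simp add: Suc power_Suc2 Y_def del: power_Suc)
    also have "\<dots> = 1 + of_nat (Suc k) * Y"
      by (simp add: algebra_simps YY mult.assoc)
    finally show ?case .
  qed simp
  from this[of n] have "sc (of_nat n) * Y = 0" using assms(1) by (simp add: sc_of_nat)
  then show ?thesis using \<open>n > 0\<close> by (simp add: sc_mult_eq_0_iff Y_def)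
qed

lemma commute_if_tr_commutator_eq_2:
  assumes "dt A = 1" "dt B = 1" "(A * B * adj A * adj B) ^ n = 1" "n > 0"
    and "tr (A * B * adj A * adj B) = 2"
  shows "A * B = B * A"
proof -
  have K: "A * B * adj A * adj B = 1"
    by (rule torsion_trace_2[OF assms(3,4) _ assms(5)]) (simp add: dt_mult assms(1,2))
  have "B * A = A * B * adj A * adj B * (B * A)" by (simp only: K mult_1)
  also have "\<dots> = A * B * (adj A * ((adj B * B) * A))" by (simp only: mult.assoc)
  also have "\<dots> = A * B" by (simp only: adj_mult_self assms(1,2) sc_1 mult_1 mult_1_right)
  finally show ?thesis by simp
qed

section \<open>Arithmetic in the coordinates of \<open>comb\<close>\<close>

lemma comb_add: "comb A B x y z w + comb A B x' y' z' w' = comb A B (x + x') (y + y') (z + z') (w + w')"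
  by (simp add: comb_def sc_add algebra_simps)

lemma sc_mult_comb: "sc r * comb A B x y z w = comb A B (r * x) (r * y) (r * z) (r * w)"
  by (simp add: comb_def sc_mult algebra_simps mult.assoc)

lemma mult_comb_left:
  assumes "dt A = 1"
  shows "A * comb A B x y z w = comb A B (- y) (x + tr A * y) (- w) (z + tr A * w)"
proof -
  have "A * comb A B x y z w
      = comb A B (- dt A * y) (x + tr A * y) (- dt A * w) (z + tr A * w)"
    by (simp add: comb_def m2_defs m2_eq_iff algebra_simps)
  then show ?thesis using assms by simp
qed

text \<open>Again a multiplication from the left, now by the second basis matrix; the coefficients
  come from reordering \<open>B * A\<close> as in \<open>swap_eq\<close>.\<close>

lemma mult_comb_right:
  assumes "dt B = 1"
  shows "B * comb A B x y z w = comb A B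
    (y * (tr (A * B) - tr A * tr B) - z - tr A * w) (tr B * y + w)
    (x + tr A * y + tr B * z + tr (A * B) * w) (- y)"
proof -
  have "B * comb A B x y z w = comb A B
    (y * (tr (A * B) - tr A * tr B) - dt B * z - dt B * tr A * w) (tr B * y + dt B * w)
    (x + tr A * y + tr B * z + tr (A * B) * w) (- y)"
    unfolding m2_eq_iff comb_def m2_defs m2.sel
    by (intro conjI; simp add: algebra_simps)
  then show ?thesis using assms by simp
qed

text \<open>The generated monoid suffices: in the application the letters come from generators and
  their inverses.\<close>

inductive_set words :: "m2 set \<Rightarrow> m2 set" for T where
  one: "1 \<in> words T"
| mult: "A \<in> T \<Longrightarrow> M \<in> words T \<Longrightarrow> A * M \<in> words T"

lemma words_dt: "M \<in> words T \<Longrightarrow> (\<And>A. A \<in> T \<Longrightarrow> dt A = 1) \<Longrightarrow> dt M = 1"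
  by (induction rule: words.induct) (auto simp: dt_mult)

lemma power_mod_order:
  fixes x :: "'a::monoid_mult"
  assumes "x ^ n = 1"
  shows "x ^ (k mod n) = x ^ k"
proof -
  have "x ^ k = x ^ (n * (k div n) + k mod n)" by simp
  also have "\<dots> = x ^ (k mod n)" using assms by (simp only: power_add power_mult power_one mult_1)
  finally show ?thesis by simp
qed

text \<open>Powers of each newly added generator are collected in front, with exponents modulo
  \<open>n\<close>.\<close>

lemma finite_words_commuting:
  assumes "finite T" "n > 0" "\<And>A. A \<in> T \<Longrightarrow> A ^ n = 1"
    and "\<And>A B. A \<in> T \<Longrightarrow> B \<in> T \<Longrightarrow> A * B = B * A"
  shows "finite (words T)"
  using assms(1,3,4)
proof (induction T)
  case empty
  have "M = 1" if "M \<in> words {}" for M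
    using that by (induction rule: words.induct) auto
  then have "words {} \<subseteq> {1}" by blast
  then show ?case using finite_subset by blast
next
  case (insert C T)
  have "words (insert C T) \<subseteq> (\<lambda>(k, M). C ^ k * M) ` ({..<n} \<times> words T)"
  proof
    fix M assume "M \<in> words (insert C T)"
    then have "\<exists>k P. k < n \<and> P \<in> words T \<and> M = C ^ k * P"
    proof (induction rule: words.induct)
      case one
      then show ?case using \<open>n > 0\<close> words.one by (intro exI[of _ 0] exI[of _ 1]) auto
    next
      case (mult B M)
      then obtain k P where kP: "k < n" "P \<in> words T" "M = C ^ k * P" by blast
      show ?case
      proof (cases "B = C")
        case True
        have "C ^ Suc k = C ^ (Suc k mod n)"
          using insert.prems(1)[of C]
          by (simp add: power_mod_order)
        then have "B * M = C ^ (Suc k mod n) * P"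
          using True kP(3) by (simp flip: mult.assoc)
        then show ?thesis using \<open>n > 0\<close> kP(2) by (meson mod_less_divisor)
      next
        case False
        then have "B \<in> T" using mult by blast
        have "B * C ^ k = C ^ k * B"
          by (metis power_commuting_commutes insert.prems(2) mult(1) insertI1)
        then have "B * M = C ^ k * (B * P)"
          using kP(3) by (simp flip: mult.assoc)
        then show ?thesis using kP(1,2) \<open>B \<in> T\<close> words.mult by blast
      qed
    qed
    then show "M \<in> (\<lambda>(k, M). C ^ k * M) ` ({..<n} \<times> words T)" by force
  qed
  moreover have "finite (words T)" using insert by blast
  ultimately show ?case by (meson finite_SigmaI finite_lessThan finite_surj)
qed

subsection \<open>Torsion conditions in the special linear group\<close>

context cyclotomic
begin

section \<open>Elements with only real conjugates\<close>

definition R_real :: "complex set" where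
  "R_real = {x \<in> R. \<forall>w\<in>\<Omega>. \<sigma> w x \<in> \<real>}"

text \<open>The real-valued form of \<open>\<sigma>\<close>, meaningful on \<open>R_real\<close> and
  for \<open>w\<close> in \<open>\<Omega>\<close>; it is unrelated to the homomorphism
  \<open>\<rho>\<close> of the theorem.\<close>

definition \<rho> :: "complex \<Rightarrow> complex \<Rightarrow> real" where
  "\<rho> w x = Re (\<sigma> w x)"

lemma R_real_R: "x \<in> R_real \<Longrightarrow> x \<in> R"
  by (simp add: R_real_def)

lemma R_real_of_int [simp]: "of_int n \<in> R_real"
  by (simp add: R_real_def)
lemma R_real_numeral [simp]: "0 \<in> R_real" "1 \<in> R_real" "numeral n \<in> R_real"
  using R_real_of_int[of 0] R_real_of_int[of 1] R_real_of_int[of "numeral n"] by simp_all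
lemma R_real_add [simp]: "x \<in> R_real \<Longrightarrow> y \<in> R_real \<Longrightarrow> x + y \<in> R_real"
  by (simp add: R_real_def)
lemma R_real_diff [simp]: "x \<in> R_real \<Longrightarrow> y \<in> R_real \<Longrightarrow> x - y \<in> R_real"
  by (simp add: R_real_def)
lemma R_real_mult [simp]: "x \<in> R_real \<Longrightarrow> y \<in> R_real \<Longrightarrow> x * y \<in> R_real"
  by (simp add: R_real_def)
lemma R_real_uminus [simp]: "x \<in> R_real \<Longrightarrow> - x \<in> R_real"
  using R_real_diff[of 0 x] by simp

context
  fixes w assumes w: "w \<in> \<Omega>"
begin

lemma sigma_eq_rho: "x \<in> R_real \<Longrightarrow> \<sigma> w x = of_real (\<rho> w x)"
  using w by (simp add: R_real_def \<rho>_def)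

lemma rho_of_int [simp]: "\<rho> w (of_int n) = of_int n"
  using w by (simp add: \<rho>_def)
lemma rho_numeral [simp]: "\<rho> w 0 = 0" "\<rho> w 1 = 1" "\<rho> w (numeral n) = numeral n"
  using rho_of_int[of 0] rho_of_int[of 1] rho_of_int[of "numeral n"] by simp_all
lemma rho_add [simp]: "x \<in> R_real \<Longrightarrow> y \<in> R_real \<Longrightarrow> \<rho> w (x + y) = \<rho> w x + \<rho> w y"
  using w by (simp add: \<rho>_def R_real_R)
lemma rho_diff [simp]: "x \<in> R_real \<Longrightarrow> y \<in> R_real \<Longrightarrow> \<rho> w (x - y) = \<rho> w x - \<rho> w y"
  using w by (simp add: \<rho>_def R_real_R)
lemma rho_mult [simp]: "x \<in> R_real \<Longrightarrow> y \<in> R_real \<Longrightarrow> \<rho> w (x * y) = \<rho> w x * \<rho> w y"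
proof -
  assume xy: "x \<in> R_real" "y \<in> R_real"
  then have "\<sigma> w (x * y) = of_real (\<rho> w x * \<rho> w y)"
    using w by (simp add: R_real_R sigma_eq_rho)
  then show ?thesis by (simp add: \<rho>_def[of w "x * y"])
qed
lemma rho_eq_0_iff: "x \<in> R_real \<Longrightarrow> \<rho> w x = 0 \<longleftrightarrow> x = 0"
  using sigma_eq_0_iff[OF w R_real_R, of x] sigma_eq_rho[of x] by simp

end

text \<open>A conjugate of the root of unity \<open>u\<close> is again one, so it has modulus
  \<open>1\<close> and its inverse is its complex conjugate. The trace therefore goes to twice a
  real part.\<close>

lemma torsion_trace_real:
  assumes "M ^ N = 1" "dt M = 1"
  shows "tr M \<in> R_real" and "w \<in> \<Omega> \<Longrightarrow> \<bar>\<rho> w (tr M)\<bar> \<le> 2"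
proof -
  obtain u where u: "u ^ N = 1" "tr M = u + inverse u"
    using torsion_trace[OF assms] by blast
  have "inverse u ^ N = 1" using u(1) by (simp add: power_inverse)
  with u(1) have uR: "u \<in> R" "inverse u \<in> R" by (simp_all add: R_root)
  have "u \<noteq> 0" using u(1) N_pos by (metis power_0_left zero_neq_one less_numeral_extra(3))
  have \<sigma>: "\<sigma> w (tr M) = of_real (2 * Re (\<sigma> w u)) \<and> cmod (\<sigma> w u) = 1" if w: "w \<in> \<Omega>" for w
  proof -
    have "\<sigma> w u ^ N = 1" using sigma_power[OF w uR(1), of N] u(1) w by simp
    then have "cmod (\<sigma> w u) ^ N = 1 ^ N" by (simp flip: norm_power)
    then have norm: "cmod (\<sigma> w u) = 1" using N_pos power_eq_iff_eq_base[of N "cmod (\<sigma> w u)" 1] by simp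
    have "\<sigma> w u * \<sigma> w (inverse u) = 1"
      using sigma_mult[OF w uR] w \<open>u \<noteq> 0\<close> by simp
    moreover have "\<sigma> w u * cnj (\<sigma> w u) = 1"
      using norm by (simp flip: complex_norm_square)
    ultimately have "\<sigma> w (inverse u) = cnj (\<sigma> w u)"
      by (metis mult.commute mult.right_neutral mult.assoc)
    then have "\<sigma> w (tr M) = \<sigma> w u + cnj (\<sigma> w u)" using uR u(2) w by simp
    with norm show ?thesis by (simp add: complex_add_cnj)
  qed
  show "tr M \<in> R_real"
    using uR \<sigma> by (auto simp: R_real_def u(2))
  show "\<bar>\<rho> w (tr M)\<bar> \<le> 2" if "w \<in> \<Omega>"
    using \<sigma>[OF that] abs_Re_le_cmod[of "\<sigma> w u"] by (simp add: \<rho>_def)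
qed

text \<open>The \<open>R_real\<close>-algebra generated by \<open>T\<close>, presented through left
  multiplication by single letters so that inductions proceed letter by letter.\<close>

inductive_set alg :: "m2 set \<Rightarrow> m2 set" for T where
  scalar: "r \<in> R_real \<Longrightarrow> sc r \<in> alg T"
| add: "M \<in> alg T \<Longrightarrow> P \<in> alg T \<Longrightarrow> M + P \<in> alg T"
| mult: "A \<in> T \<Longrightarrow> M \<in> alg T \<Longrightarrow> A * M \<in> alg T"

lemma alg_scale: "M \<in> alg T \<Longrightarrow> r \<in> R_real \<Longrightarrow> sc r * M \<in> alg T"
proof (induction rule: alg.induct)
  case (scalar s)
  then show ?case using alg.scalar[of "r * s" T] by (simp add: sc_mult)
next
  case (add M P)
  then show ?case using alg.add by (simp add: distrib_left)
next
  case (mult A M)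
  then show ?case using alg.mult[of A T "sc r * M"] by (simp add: sc_left_commute)
qed

lemma alg_diff: "M \<in> alg T \<Longrightarrow> P \<in> alg T \<Longrightarrow> M - P \<in> alg T"
  using alg.add[of M T "sc (-1) * P"] alg_scale[of P T "-1"] by (simp add: sc_uminus)

lemma words_alg: "M \<in> words T \<Longrightarrow> M \<in> alg T"
proof (induction rule: words.induct)
  case one
  then show ?case using alg.scalar[of 1 T] by simp
qed (rule alg.mult)

text \<open>Each exchange of \<open>C\<close> with a letter by \<open>swap_eq\<close> costs only
  coefficients in \<open>R_real\<close> and leaves at most one \<open>C\<close>, at the right
  end.\<close>

lemma alg_commute_past:
  assumes "M \<in> alg T" "tr C \<in> R_real"
    and T: "\<And>B. B \<in> T \<Longrightarrow> tr B \<in> R_real" "\<And>B. B \<in> T \<Longrightarrow> tr (B * C) \<in> R_real"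
  shows "\<exists>P Q. P \<in> alg T \<and> Q \<in> alg T \<and> C * M = P + Q * C"
  using assms(1)
proof (induction rule: alg.induct)
  case (scalar r)
  then show ?case using alg.scalar[of 0 T] alg.scalar[of r T]
    by (intro exI[of _ 0] exI[of _ "sc r"]) (simp add: sc_commute)
next
  case (add M M')
  then obtain P Q P' Q' where "P \<in> alg T" "Q \<in> alg T" "C * M = P + Q * C"
    "P' \<in> alg T" "Q' \<in> alg T" "C * M' = P' + Q' * C" by blast
  then show ?case using alg.add
    by (intro exI[of _ "P + P'"] exI[of _ "Q + Q'"]) (simp add: algebra_simps)
next
  case (mult B M)
  then obtain P Q where PQ: "P \<in> alg T" "Q \<in> alg T" "C * M = P + Q * C" by blast
  let ?s = "tr (B * C) - tr B * tr C"
  have "C * (B * M) = (sc (tr B) * C + sc (tr C) * B + sc ?s - B * C) * M"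
    by (simp add: swap_eq[of C B] flip: mult.assoc)
  also have "\<dots> = sc (tr B) * (C * M) + sc (tr C) * (B * M) + sc ?s * M - B * (C * M)"
    by (simp add: algebra_simps)
  also have "\<dots> = (sc (tr B) * P + sc (tr C) * (B * M) + sc ?s * M - B * P)
      + (sc (tr B) * Q - B * Q) * C"
    by (simp add: PQ(3) algebra_simps)
  finally have "C * (B * M) = (sc (tr B) * P + sc (tr C) * (B * M) + sc ?s * M - B * P)
      + (sc (tr B) * Q - B * Q) * C" .
  moreover have "sc (tr B) * P + sc (tr C) * (B * M) + sc ?s * M - B * P \<in> alg T"
    using PQ(1) mult(1,2) assms(2) T by (simp add: alg_diff alg.add alg_scale alg.mult)
  moreover have "sc (tr B) * Q - B * Q \<in> alg T"
    using PQ(2) mult(1) T by (simp add: alg_diff alg_scale alg.mult)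
  ultimately show ?case by blast
qed

text \<open>Since \<open>C\<close> moves past the other generators and satisfies a quadratic equation, adjoining
  it to the algebra only doubles the number of module generators.\<close>

lemma alg_insert:
  assumes "M \<in> alg (insert C T)" "tr C \<in> R_real" "dt C = 1"
    and T: "\<And>B. B \<in> T \<Longrightarrow> tr B \<in> R_real" "\<And>B. B \<in> T \<Longrightarrow> tr (B * C) \<in> R_real"
  shows "\<exists>P Q. P \<in> alg T \<and> Q \<in> alg T \<and> M = P + Q * C"
  using assms(1)
proof (induction rule: alg.induct)
  case (scalar r)
  then show ?case using alg.scalar[of 0 T] alg.scalar[of r T]
    by (intro exI[of _ "sc r"] exI[of _ 0]) simp
next
  case (add M M')
  then obtain P Q P' Q' where "P \<in> alg T" "Q \<in> alg T" "M = P + Q * C"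
    "P' \<in> alg T" "Q' \<in> alg T" "M' = P' + Q' * C" by blast
  then show ?case using alg.add
    by (intro exI[of _ "P + P'"] exI[of _ "Q + Q'"]) (simp add: algebra_simps)
next
  case (mult B M)
  then obtain P Q where PQ: "P \<in> alg T" "Q \<in> alg T" "M = P + Q * C" by blast
  show ?case
  proof (cases "B = C")
    case True
    obtain P1 P2 where P: "P1 \<in> alg T" "P2 \<in> alg T" "C * P = P1 + P2 * C"
      using alg_commute_past[OF PQ(1) assms(2) T] by blast
    obtain Q1 Q2 where Q: "Q1 \<in> alg T" "Q2 \<in> alg T" "C * Q = Q1 + Q2 * C"
      using alg_commute_past[OF PQ(2) assms(2) T] by blast
    have CC: "Q2 * (C * C) = sc (tr C) * (Q2 * C) - Q2"
      by (simp add: square_eq[of C] assms(3) right_diff_distrib sc_left_commute)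
    have "B * M = C * P + (C * Q) * C" by (simp add: True PQ(3) algebra_simps)
    also have "\<dots> = P1 + P2 * C + Q1 * C + Q2 * (C * C)"
      by (simp add: P(3) Q(3) algebra_simps)
    also have "\<dots> = (P1 - Q2) + (P2 + Q1 + sc (tr C) * Q2) * C"
      by (simp add: CC algebra_simps)
    finally have "B * M = (P1 - Q2) + (P2 + Q1 + sc (tr C) * Q2) * C" .
    moreover have "P1 - Q2 \<in> alg T" "P2 + Q1 + sc (tr C) * Q2 \<in> alg T"
      using P(1,2) Q(1,2) assms(2) by (simp_all add: alg_diff alg.add alg_scale)
    ultimately show ?thesis by blast
  next
    case False
    then have "B \<in> T" using mult by blast
    then have "B * P \<in> alg T" "B * Q \<in> alg T" using PQ alg.mult by auto
    moreover have "B * M = B * P + (B * Q) * C" by (simp add: PQ(3) algebra_simps)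
    ultimately show ?thesis by blast
  qed
qed

text \<open>Under the hypotheses of \<open>order_set_mult\<close> this is closed under products: an
  order in the sense of quaternion algebras.\<close>

definition order_set :: "m2 \<Rightarrow> m2 \<Rightarrow> m2 set" where
  "order_set A B = {comb A B x y z w |x y z w. {x, y, z, w} \<subseteq> R_real}"

lemma order_set_I: "{x, y, z, w} \<subseteq> R_real \<Longrightarrow> comb A B x y z w \<in> order_set A B"
  by (auto simp: order_set_def)

lemma order_set_E:
  assumes "M \<in> order_set A B"
  obtains x y z w where "M = comb A B x y z w" "x \<in> R_real" "y \<in> R_real" "z \<in> R_real" "w \<in> R_real"
  using assms by (auto simp: order_set_def)

lemma order_set_add:
  assumes "M \<in> order_set A B" "P \<in> order_set A B" shows "M + P \<in> order_set A B"
  using assms by (elim order_set_E) (simp add: comb_add order_set_I)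

lemma order_set_scale:
  assumes "M \<in> order_set A B" "r \<in> R_real" shows "sc r * M \<in> order_set A B"
  using assms by (elim order_set_E) (simp add: sc_mult_comb order_set_I)

lemma order_set_mult:
  assumes "dt A = 1" "dt B = 1" "{tr A, tr B, tr (A * B)} \<subseteq> R_real"
    and "M \<in> order_set A B" "P \<in> order_set A B"
  shows "M * P \<in> order_set A B"
proof -
  have A: "A * Q \<in> order_set A B" if "Q \<in> order_set A B" for Q
    using that assms(3) by (elim order_set_E) (simp add: mult_comb_left[OF assms(1)] order_set_I)
  have B: "B * Q \<in> order_set A B" if "Q \<in> order_set A B" for Q
    using that assms(3) by (elim order_set_E) (simp add: mult_comb_right[OF assms(2)] order_set_I)
  obtain x y z w where M: "M = comb A B x y z w"
      "x \<in> R_real" "y \<in> R_real" "z \<in> R_real" "w \<in> R_real"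
    using assms(4) by (rule order_set_E)
  have "M * P = sc x * P + sc y * (A * P) + sc z * (B * P) + sc w * (A * (B * P))"
    by (simp add: M(1) comb_def algebra_simps)
  then show ?thesis using assms(5) M(2-) by (simp add: order_set_add order_set_scale A B)
qed

section \<open>Finiteness from torsion of words of length at most three and of commutators\<close>

context
  fixes T :: "m2 set"
  assumes fin: "finite T"
    and dt_T: "\<And>A. A \<in> T \<Longrightarrow> dt A = 1"
    and tors1: "\<And>A. A \<in> T \<Longrightarrow> A ^ N = 1"
    and tors2: "\<And>A B. A \<in> T \<Longrightarrow> B \<in> T \<Longrightarrow> (A * B) ^ N = 1"
    and tors3: "\<And>A B C. A \<in> T \<Longrightarrow> B \<in> T \<Longrightarrow> C \<in> T \<Longrightarrow> (A * B * C) ^ N = 1"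
    and tors4: "\<And>A B. A \<in> T \<Longrightarrow> B \<in> T \<Longrightarrow> (A * B * adj A * adj B) ^ N = 1"
begin

lemma trace_T:
  "A \<in> T \<Longrightarrow> tr A \<in> R_real"
  "A \<in> T \<Longrightarrow> B \<in> T \<Longrightarrow> tr (A * B) \<in> R_real"
  "A \<in> T \<Longrightarrow> B \<in> T \<Longrightarrow> C \<in> T \<Longrightarrow> tr (A * B * C) \<in> R_real"
  using torsion_trace_real(1) tors1 tors2 tors3 by (simp_all add: dt_T dt_mult)

text \<open>The dual basis coefficients are polynomials in traces of products of at most three
  generators, so the discriminant is the only denominator.\<close>

lemma disc_scaled_generator:
  assumes "A \<in> T" "B \<in> T" "C \<in> T"
  shows "sc (disc (tr A) (tr B) (tr (A * B))) * C \<in> order_set A B"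
proof -
  let ?a = "tr A" and ?b = "tr B" and ?c = "tr (A * B)"
    and ?f0 = "tr C" and ?f1 = "tr (C * adj A)" and ?f2 = "tr (C * adj B)"
    and ?f3 = "tr (C * adj (A * B))"
  have R: "?a \<in> R_real" "?b \<in> R_real" "?c \<in> R_real" "?f0 \<in> R_real"
      "?f1 \<in> R_real" "?f2 \<in> R_real" "?f3 \<in> R_real"
    using assms trace_T(3)[of C A B] by (simp_all add: trace_T tr_mult_adj mult.assoc)
  have "sc (disc ?a ?b ?c) * C = comb A B
     (2 * ?f0 - ?a * ?f1 - ?b * ?f2 + (?a * ?b - ?c) * ?f3)
     (- ?a * ?f0 + 2 * ?f1 + ?c * ?f2 - ?b * ?f3)
     (- ?b * ?f0 + ?c * ?f1 + 2 * ?f2 - ?a * ?f3)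
     ((?a * ?b - ?c) * ?f0 - ?b * ?f1 - ?a * ?f2 + 2 * ?f3)"
    using dual_basis_homogeneous[of A B C] dt_T[OF assms(1)] dt_T[OF assms(2)]
    by (simp add: disc_def)
  also have "\<dots> \<in> order_set A B"
    using R by (intro order_set_I) simp
  finally show ?thesis .
qed

text \<open>Generators are adjoined one at a time, whence the auxiliary subset \<open>T'\<close>. By
  \<open>alg_insert\<close> each contributes one further factor \<open>\<Delta>\<close> to the
  denominator.\<close>

lemma common_denominator:
  assumes "A \<in> T" "B \<in> T" and \<Delta>: "disc (tr A) (tr B) (tr (A * B)) \<noteq> 0" and "T' \<subseteq> T"
  shows "\<exists>D\<in>R_real. D \<noteq> 0 \<and> (\<forall>M\<in>alg T'. sc D * M \<in> order_set A B)"
proof -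
  define \<Delta> where "\<Delta> = disc (tr A) (tr B) (tr (A * B))"
  have \<Delta>R: "\<Delta> \<in> R_real" using assms(1,2) by (simp add: \<Delta>_def disc_def trace_T)
  have mult: "M * P \<in> order_set A B" if "M \<in> order_set A B" "P \<in> order_set A B" for M P
    using that assms(1,2) by (intro order_set_mult) (simp_all add: dt_T trace_T)
  have "finite T'" using fin assms(4) finite_subset by blast
  then show ?thesis using assms(4)
  proof (induction T')
    case empty
    have "M \<in> order_set A B" if "M \<in> alg {}" for M
      using that
    proof (induction rule: alg.induct)
      case (scalar r)
      then show ?case using order_set_I[of r 0 0 0 A B] by (simp add: comb_def)
    qed (auto intro: order_set_add)
    then show ?case by (intro bexI[of _ 1]) auto
  next
    case (insert C T')
    then obtain D where D: "D \<in> R_real" "D \<noteq> 0" "\<And>M. M \<in> alg T' \<Longrightarrow> sc D * M \<in> order_set A B"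
      by auto
    have C: "sc \<Delta> * C \<in> order_set A B"
      using disc_scaled_generator assms(1,2) insert.prems by (simp add: \<Delta>_def)
    have "sc (D * \<Delta>) * M \<in> order_set A B" if M: "M \<in> alg (insert C T')" for M
    proof -
      obtain P Q where PQ: "P \<in> alg T'" "Q \<in> alg T'" "M = P + Q * C"
        using alg_insert[OF M] insert.prems by (auto simp: trace_T dt_T subset_iff)
      have "sc (D * \<Delta>) * M = sc \<Delta> * (sc D * P) + (sc D * Q) * (sc \<Delta> * C)"
        unfolding sc_mult_mult PQ(3) distrib_left
        by (simp only: mult.commute[of D] sc_mult mult.assoc)
      then show ?thesis using PQ D C \<Delta>R by (simp add: order_set_add order_set_scale mult)
    qed
    then show ?case using D(1,2) \<Delta>R assms(3) by (intro bexI[of _ "D * \<Delta>"]) (auto simp: \<Delta>_def)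
  qed
qed

lemma disc_commutator:
  assumes "A \<in> T" "B \<in> T"
  shows "tr (A * B * adj A * adj B) = 2 - disc (tr A) (tr B) (tr (A * B))"
  using assms by (simp add: tr_commutator dt_T disc_def power2_eq_square)

text \<open>The conjugated commutator trace is at most \<open>2\<close>, so the conjugated
  discriminant is nonnegative. It is nonzero because the discriminant is: commutator trace
  \<open>2\<close> would make \<open>A\<close> and \<open>B\<close> commute.\<close>

lemma rho_disc_pos:
  assumes "A \<in> T" "B \<in> T" "A * B \<noteq> B * A" "w \<in> \<Omega>"
  shows "disc (tr A) (tr B) (tr (A * B)) \<noteq> 0"
    and "disc (\<rho> w (tr A)) (\<rho> w (tr B)) (\<rho> w (tr (A * B))) > 0"
proof -
  let ?\<Delta> = "disc (tr A) (tr B) (tr (A * B))"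
  have R: "?\<Delta> \<in> R_real" using assms(1,2) by (simp add: disc_def trace_T)
  show nz: "?\<Delta> \<noteq> 0"
    using commute_if_tr_commutator_eq_2[of A B N] assms tors4 N_pos
    by (auto simp: dt_T disc_commutator)
  have "\<rho> w (2 - ?\<Delta>) \<le> 2"
    using torsion_trace_real(2)[OF tors4[OF assms(1,2)], of w] assms
    by (simp add: dt_mult dt_T disc_commutator)
  then have "\<rho> w ?\<Delta> > 0"
    using rho_eq_0_iff[OF assms(4) R] nz R assms(4) by simp
  moreover have "\<rho> w ?\<Delta> = disc (\<rho> w (tr A)) (\<rho> w (tr B)) (\<rho> w (tr (A * B)))"
    using assms by (simp add: disc_def trace_T)
  ultimately show "disc (\<rho> w (tr A)) (\<rho> w (tr B)) (\<rho> w (tr (A * B))) > 0" by simp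
qed

lemma finite_words_noncommuting:
  assumes "A \<in> T" "B \<in> T" "A * B \<noteq> B * A"
  shows "finite (words T)"
proof -
  let ?a = "tr A" and ?b = "tr B" and ?c = "tr (A * B)"
  \<comment> \<open>\<open>rho_disc_pos\<close> asks for some conjugate, and \<open>\<zeta>\<close>
    itself serves.\<close>
  have "\<zeta> \<in> \<Omega>" by (simp add: \<Omega>_def)
  then have nz: "disc ?a ?b ?c \<noteq> 0" using rho_disc_pos(1) assms by blast
  obtain D where D: "D \<in> R_real" "D \<noteq> 0" "\<And>M. M \<in> alg T \<Longrightarrow> sc D * M \<in> order_set A B"
    using common_denominator[OF assms(1,2) nz subset_refl] by blast
  \<comment> \<open>Since \<open>sc D * M\<close> has determinant \<open>D * D\<close>,
    \<open>norm_form_bounds\<close> gives this bound for every conjugated coordinate, uniformly in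
    the word \<open>M\<close>.\<close>
  define f where "f w = sqrt (4 * (\<rho> w D)\<^sup>2 / disc (\<rho> w ?a) (\<rho> w ?b) (\<rho> w ?c))" for w
  define Bd where "Bd = {x \<in> R. \<forall>w\<in>\<Omega>. cmod (\<sigma> w x) \<le> f w}"
  have "finite Bd" unfolding Bd_def by (rule finite_bounded_conjugates)
  have "words T \<subseteq> (\<lambda>(x, y, z, w). sc (inverse D) * comb A B x y z w) ` (Bd \<times> Bd \<times> Bd \<times> Bd)"
  proof
    fix M assume M: "M \<in> words T"
    obtain x y z w where DM: "sc D * M = comb A B x y z w"
      and R: "x \<in> R_real" "y \<in> R_real" "z \<in> R_real" "w \<in> R_real"
      by (rule order_set_E[OF D(3)[OF words_alg[OF M]]])
    have "dt (sc D * M) = D * D" using words_dt[OF M] dt_T by (simp add: dt_mult dt_sc power2_eq_square)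
    then have nf: "norm_form ?a ?b ?c x y z w = D * D"
      using assms(1,2) by (simp add: DM dt_comb dt_T)
    have "t \<in> Bd" if t: "t \<in> {x, y, z, w}" for t
    proof -
      have tR: "t \<in> R_real" using t R by auto
      have "cmod (\<sigma> v t) \<le> f v" if v: "v \<in> \<Omega>" for v
      proof -
        let ?d = "disc (\<rho> v ?a) (\<rho> v ?b) (\<rho> v ?c)"
        have pos: "?d > 0" using rho_disc_pos(2) assms v by blast
        have "norm_form (\<rho> v ?a) (\<rho> v ?b) (\<rho> v ?c) (\<rho> v x) (\<rho> v y) (\<rho> v z) (\<rho> v w)
            = \<rho> v (norm_form ?a ?b ?c x y z w)"
          using R v assms(1,2) by (simp add: norm_form_def trace_T)
        also have "\<dots> = (\<rho> v D)\<^sup>2" using D(1) v by (simp add: nf power2_eq_square)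
        finally have nf': "norm_form (\<rho> v ?a) (\<rho> v ?b) (\<rho> v ?c) (\<rho> v x) (\<rho> v y) (\<rho> v z) (\<rho> v w)
            = (\<rho> v D)\<^sup>2" .
        have "\<bar>\<rho> v ?a\<bar> \<le> 2" using torsion_trace_real(2) tors1 dt_T assms(1) v by blast
        then have "?d * (\<rho> v t * \<rho> v t) \<le> 4 * (\<rho> v D)\<^sup>2"
          using norm_form_bounds[OF pos, of "\<rho> v t" "\<rho> v x" "\<rho> v y" "\<rho> v z" "\<rho> v w"] t
          unfolding nf' by auto
        then have "\<bar>\<rho> v t\<bar>\<^sup>2 \<le> 4 * (\<rho> v D)\<^sup>2 / ?d"
          using pos by (simp add: pos_le_divide_eq power2_eq_square mult.commute)
        then have "\<bar>\<rho> v t\<bar> \<le> f v" unfolding f_def by (rule real_le_rsqrt)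
        then show ?thesis by (simp add: sigma_eq_rho[OF v tR])
      qed
      then show ?thesis using tR by (simp add: Bd_def R_real_R)
    qed
    moreover have "M = sc (inverse D) * comb A B x y z w"
    proof -
      have "sc (inverse D) * comb A B x y z w = sc (inverse D * D) * M"
        by (simp only: sc_mult mult.assoc flip: DM)
      then show ?thesis using D(2) by simp
    qed
    ultimately show "M \<in> (\<lambda>(x, y, z, w). sc (inverse D) * comb A B x y z w) ` (Bd \<times> Bd \<times> Bd \<times> Bd)"
      by (intro image_eqI[of _ _ "(x, y, z, w)"]) auto
  qed
  then show ?thesis using \<open>finite Bd\<close> by (meson finite_SigmaI finite_surj)
qed

lemma finite_words: "finite (words T)"
  using finite_words_commuting[OF fin N_pos tors1] finite_words_noncommuting by blast

end

end

subsection \<open>Reduction to the special linear group\<close>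

text \<open>The counterpart of \<open>is_torsion\<close> for type-class monoids, applicable to
  matrices and to scalars.\<close>

definition finite_order :: "'a::monoid_mult \<Rightarrow> bool" where
  "finite_order x \<longleftrightarrow> (\<exists>n>0. x ^ n = 1)"

lemma finite_order_1 [simp]: "finite_order 1"
  unfolding finite_order_def by (rule exI[of _ 1]) simp

lemma finite_order_commuting_mult:
  assumes "finite_order x" "finite_order y" "x * y = y * x"
  shows "finite_order (x * y)"
proof -
  obtain m n where mn: "m > 0" "x ^ m = 1" "n > 0" "y ^ n = 1"
    using assms by (auto simp: finite_order_def)
  have "(x * y) ^ k = x ^ k * y ^ k" for k
  proof (induction k)
    case (Suc k)
    have "y * x ^ k = x ^ k * y" using assms(3) by (metis power_commuting_commutes)
    then have "x * y * (x ^ k * y ^ k) = x * x ^ k * (y * y ^ k)"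
      by (metis mult.assoc)
    then show ?case by (simp add: Suc)
  qed simp
  from this[of "m * n"] have "(x * y) ^ (m * n) = x ^ (m * n) * y ^ (m * n)" .
  also have "x ^ (m * n) = 1" using mn by (simp only: power_mult power_one)
  also have "y ^ (m * n) = 1" using mn by (simp only: mult.commute[of m] power_mult power_one)
  finally show ?thesis using mn unfolding finite_order_def
    by (intro exI[of _ "m * n"]) simp
qed

lemma finite_order_mult: "finite_order x \<Longrightarrow> finite_order y \<Longrightarrow> finite_order (x * y)"
  for x y :: "'a::comm_monoid_mult"
  by (rule finite_order_commuting_mult) (simp_all add: mult.commute)

lemma finite_order_sc: "finite_order c \<Longrightarrow> finite_order (sc c)"
  unfolding finite_order_def by (metis sc_1 sc_power)

lemma finite_order_sc_mult: "finite_order c \<Longrightarrow> finite_order M \<Longrightarrow> finite_order (sc c * M)"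
  by (intro finite_order_commuting_mult finite_order_sc) (simp_all add: sc_commute)

lemma finite_order_inverse: "finite_order c \<Longrightarrow> finite_order (inverse c)" for c :: complex
  unfolding finite_order_def by (auto simp: power_inverse)

lemma common_exponent:
  fixes Q :: "'a::monoid_mult set"
  assumes "finite Q" "\<And>x. x \<in> Q \<Longrightarrow> finite_order x"
  obtains N where "N > 0" "\<And>x. x \<in> Q \<Longrightarrow> x ^ N = 1"
proof -
  have "\<exists>N>0. \<forall>x\<in>Q. x ^ N = 1"
    using assms
  proof (induction Q)
    case (insert y Q)
    then obtain N where N: "N > 0" "\<forall>x\<in>Q. x ^ N = 1" by auto
    obtain n where n: "n > 0" "y ^ n = 1"
      using insert.prems[of y] by (auto simp: finite_order_def)
    have "x ^ (N * n) = 1" if "x \<in> Q" for x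
      using N that by (simp add: power_mult)
    moreover have "y ^ (N * n) = 1"
      using n by (simp add: mult.commute[of N] power_mult)
    ultimately show ?case using N(1) n(1) by (intro exI[of _ "N * n"]) simp
  qed auto
  then show ?thesis using that by blast
qed

lemma finite_words_if_finite_order:
  assumes fin: "finite T"
    and dt: "\<And>A. A \<in> T \<Longrightarrow> dt A = 1"
    and "\<And>A. A \<in> T \<Longrightarrow> finite_order A"
    and "\<And>A B. A \<in> T \<Longrightarrow> B \<in> T \<Longrightarrow> finite_order (A * B)"
    and "\<And>A B C. A \<in> T \<Longrightarrow> B \<in> T \<Longrightarrow> C \<in> T \<Longrightarrow> finite_order (A * B * C)"
    and "\<And>A B. A \<in> T \<Longrightarrow> B \<in> T \<Longrightarrow> finite_order (A * B * adj A * adj B)"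
  shows "finite (words T)"
proof -
  define Q where "Q = T \<union> (\<lambda>(A, B). A * B) ` (T \<times> T) \<union> (\<lambda>(A, B, C). A * B * C) ` (T \<times> T \<times> T)
    \<union> (\<lambda>(A, B). A * B * adj A * adj B) ` (T \<times> T)"
  have "finite Q" using fin by (simp add: Q_def)
  moreover have "finite_order M" if "M \<in> Q" for M
    using that assms(3-) by (auto simp: Q_def)
  \<comment> \<open>A common exponent of the finitely many test matrices becomes the
    \<open>N\<close> of the cyclotomic locale.\<close>
  ultimately obtain N where N: "N > 0" "\<And>M. M \<in> Q \<Longrightarrow> M ^ N = 1"
    using common_exponent by blast
  interpret cyclotomic N by standard (rule N(1))
  show ?thesis
    by (rule finite_words[OF fin]) (rule dt N(2); force simp: Q_def)+
qed

section \<open>From short words in the group to normalised matrices\<close>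

lemma word_length_word_value_le:
  assumes "set ws \<subseteq> S \<union> m_inv F ` S"
  shows "word_length F S (word_value F ws) \<le> length ws"
  unfolding word_length_def by (rule Least_le) (use assms in blast)

context group
begin

lemma word_value_closed:
  "S \<subseteq> carrier G \<Longrightarrow> set ws \<subseteq> S \<union> m_inv G ` S \<Longrightarrow> word_value G ws \<in> carrier G"
  by (induction ws) (auto simp: word_value_def)

text \<open>The normalising scalars are roots of unity, so finite order passes to words in the
  normalised matrices, and finitely many scalars times finitely many words cover the image.\<close>

lemma finite_image_if_short_words_finite_order:
  fixes \<psi> :: "'a \<Rightarrow> m2"
  assumes S: "S \<subseteq> carrier G" "finite S" "generate G S = carrier G"
    and \<psi>_mult: "\<And>g h. g \<in> carrier G \<Longrightarrow> h \<in> carrier G \<Longrightarrow> \<psi> (g \<otimes> h) = \<psi> g * \<psi> h"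
    and \<psi>_one: "\<psi> \<one> = 1"
    and short: "\<And>g. g \<in> carrier G \<Longrightarrow> word_length G S g \<le> 3 * card S \<Longrightarrow> finite_order (\<psi> g)"
  shows "finite (\<psi> ` carrier G)"
proof -
  define S' where "S' = S \<union> m_inv G ` S"
  have S': "s \<in> carrier G" if "s \<in> S'" for s using that S(1) by (auto simp: S'_def)
  have word: "finite_order (\<psi> (word_value G ws))" if "set ws \<subseteq> S'" "length ws \<le> 3 * card S" for ws
    using short[OF word_value_closed[OF S(1)]] word_length_word_value_le[of ws S G] that
    by (auto simp: S'_def)
  \<comment> \<open>Any letter forces \<open>S\<close> to be nonempty, so words of up to three
    letters are short enough.\<close>
  have card: "card S \<ge> 1" if "s \<in> S'" for s
    using that S(2) by (auto simp: S'_def Suc_le_eq card_gt_0_iff)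
  have \<psi>_inv: "\<psi> s * \<psi> (inv s) = 1" if "s \<in> S'" for s
    using \<psi>_mult[of s "inv s"] S'[OF that] \<psi>_one by simp
  have fo1: "finite_order (\<psi> s)" if "s \<in> S'" for s
    using word[of "[s]"] that card[OF that] S'[OF that] by (simp add: word_value_def)
  have fo2: "finite_order (\<psi> s * \<psi> t)" if "s \<in> S'" "t \<in> S'" for s t
    using word[of "[s, t]"] that card[OF that(1)] S' by (simp add: word_value_def \<psi>_mult)
  have fo3: "finite_order (\<psi> s * \<psi> t * \<psi> u)" if "s \<in> S'" "t \<in> S'" "u \<in> S'" for s t u
    using word[of "[s, t, u]"] that card[OF that(1)] S' by (simp add: word_value_def \<psi>_mult mult.assoc)
  \<comment> \<open>Commutators have four letters, within the bound only from two generators on.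
    With one generator all letters commute and the commutator is trivial.\<close>
  have fo4: "finite_order (\<psi> s * \<psi> t * \<psi> (inv s) * \<psi> (inv t))" if "s \<in> S'" "t \<in> S'" for s t
  proof (cases "card S \<ge> 2")
    case True
    have "inv s \<in> S'" "inv t \<in> S'" using that S(1) by (auto simp: S'_def)
    then show ?thesis
      using word[of "[s, t, inv s, inv t]"] that True S'
      by (simp add: word_value_def \<psi>_mult mult.assoc)
  next
    case False
    then have "card S = 1" using card[OF that(1)] by linarith
    then obtain a where a: "S = {a}" by (auto simp: card_1_singleton_iff)
    then have "a \<in> carrier G" using S(1) by simp
    have st: "s = a \<or> s = inv a" "t = a \<or> t = inv a" using that by (auto simp: S'_def a)
    then have "s \<otimes> t = t \<otimes> s" using \<open>a \<in> carrier G\<close> by auto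
    then have "\<psi> s * \<psi> t = \<psi> t * \<psi> s" using \<psi>_mult S' that by metis
    then have "\<psi> s * \<psi> t * \<psi> (inv s) * \<psi> (inv t) = \<psi> t * (\<psi> s * \<psi> (inv s)) * \<psi> (inv t)"
      by (simp add: mult.assoc)
    then show ?thesis using \<psi>_inv that by simp
  qed
  define c where "c s = csqrt (dt (\<psi> s))" for s
  define B where "B s = sc (inverse (c s)) * \<psi> s" for s
  have cc: "c s * c s = dt (\<psi> s)" for s
    using power2_csqrt[of "dt (\<psi> s)"] by (simp add: c_def power2_eq_square)
  have dt_nz: "dt (\<psi> s) \<noteq> 0" if "s \<in> S'" for s
    using arg_cong[OF \<psi>_inv[OF that], of dt] by (auto simp: dt_mult)
  then have c_nz: "c s \<noteq> 0" if "s \<in> S'" for s using cc[of s] that by auto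
  have c_fo: "finite_order (c s)" if s: "s \<in> S'" for s
  proof -
    obtain n where n: "n > 0" "\<psi> s ^ n = 1" using fo1[OF s] by (auto simp: finite_order_def)
    then have "dt (\<psi> s) ^ n = 1" using dt_power[of "\<psi> s" n] by simp
    then have "c s ^ (2 * n) = 1" by (simp add: power_mult power2_eq_square cc)
    then show ?thesis using n(1) unfolding finite_order_def by (intro exI[of _ "2 * n"]) simp
  qed
  have ci_fo: "finite_order (inverse (c s))" if "s \<in> S'" for s
    using c_fo[OF that] by (rule finite_order_inverse)
  have B_mult: "B s * B t = sc (inverse (c s) * inverse (c t)) * (\<psi> s * \<psi> t)" for s t
    by (simp only: B_def sc_mult_mult)
  have dt_B: "dt (B s) = 1" if "s \<in> S'" for s
    using c_nz[OF that] by (simp add: B_def dt_mult dt_sc power2_eq_square field_simps flip: cc)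
  \<comment> \<open>The inverse of \<open>B s\<close> is expressed through
    \<open>\<psi> (inv s)\<close>; it may differ in sign from \<open>B (inv s)\<close>, whose square
    root is chosen separately.\<close>
  have adj_B: "adj (B s) = sc (c s) * \<psi> (inv s)" if s: "s \<in> S'" for s
  proof -
    have "adj (B s) * (\<psi> s * \<psi> (inv s)) = adj (B s) * B s * (sc (c s) * \<psi> (inv s))"
      using c_nz[OF s] sc_mult_mult[of "inverse (c s)" "\<psi> s" "c s" "\<psi> (inv s)"]
      by (simp add: B_def mult.assoc)
    then show ?thesis using dt_B[OF s] \<psi>_inv[OF s] by (simp add: adj_mult_self)
  qed
  define T where "T = B ` S'"
  have "finite (words T)"
  proof (rule finite_words_if_finite_order)
    show "finite T" using S(2) by (simp add: T_def S'_def)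
    show "dt A = 1" if "A \<in> T" for A
      using that dt_B by (auto simp: T_def)
    show "finite_order A" if "A \<in> T" for A
      using that by (auto simp: T_def B_def intro!: finite_order_sc_mult ci_fo fo1)
    show "finite_order (A * A')" if "A \<in> T" "A' \<in> T" for A A'
      using that by (auto simp: T_def B_mult simp del: inverse_mult_distrib
          intro!: finite_order_sc_mult[OF finite_order_mult] ci_fo fo2)
    show "finite_order (A * A' * A'')" if AT: "A \<in> T" "A' \<in> T" "A'' \<in> T" for A A' A''
    proof -
      obtain s t u where "s \<in> S'" "t \<in> S'" "u \<in> S'" "A = B s" "A' = B t" "A'' = B u"
        using AT by (auto simp: T_def)
      then show ?thesis
        by (simp only: B_def sc_mult_mult) (intro finite_order_sc_mult finite_order_mult ci_fo fo3)
    qed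
    show "finite_order (A * A' * adj A * adj A')" if AT: "A \<in> T" "A' \<in> T" for A A'
    proof -
      obtain s t where st: "s \<in> S'" "t \<in> S'" "A = B s" "A' = B t"
        using AT by (auto simp: T_def)
      \<comment> \<open>The scalars cancel in a commutator, so normalising does not change
        it.\<close>
      have "A * A' * adj A * adj A' = sc (inverse (c s) * inverse (c t) * c s * c t)
          * (\<psi> s * \<psi> t * \<psi> (inv s) * \<psi> (inv t))"
        unfolding st(3,4) adj_B[OF st(1)] adj_B[OF st(2)] B_mult sc_mult_mult ..
      also have "inverse (c s) * inverse (c t) * c s * c t = 1"
        using c_nz[OF st(1)] c_nz[OF st(2)] by (simp add: field_simps)
      finally show ?thesis using fo4[OF st(1,2)] by simp
    qed
  qed
  \<comment> \<open>Scalars collected along a word are products of values of \<open>c\<close>; a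
    common exponent confines them to the \<open>N\<close>-th roots of unity.\<close>
  obtain N where N: "N > 0" "\<And>d. d \<in> c ` S' \<Longrightarrow> d ^ N = 1"
    using common_exponent[of "c ` S'"] c_fo S(2) by (auto simp: S'_def)
  have "\<psi> ` carrier G \<subseteq> (\<lambda>(d, M). sc d * M) ` ({d. d ^ N = 1} \<times> words T)"
  proof
    fix M assume "M \<in> \<psi> ` carrier G"
    then obtain ws where ws: "set ws \<subseteq> S'" "M = \<psi> (word_value G ws)"
      using ex_word_if_generate[OF S(1)] S(3) unfolding S'_def by blast
    have "\<exists>d P. d ^ N = 1 \<and> P \<in> words T \<and> \<psi> (word_value G ws) = sc d * P"
      using ws(1)
    proof (induction ws)
      case Nil
      then show ?case using words.one by (intro exI[of _ 1]) (simp add: word_value_def \<psi>_one)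
    next
      case (Cons s ws)
      then obtain d P where dP: "d ^ N = 1" "P \<in> words T" "\<psi> (word_value G ws) = sc d * P"
        by auto
      have s: "s \<in> S'" using Cons.prems by simp
      have "\<psi> (word_value G (s # ws)) = \<psi> s * \<psi> (word_value G ws)"
        using \<psi>_mult[OF S'[OF s] word_value_closed[OF S(1), of ws]] Cons.prems
        by (simp add: word_value_def S'_def)
      also have "\<psi> s = sc (c s) * B s"
        using c_nz[OF s] by (simp add: B_def flip: mult.assoc sc_mult)
      finally have "\<psi> (word_value G (s # ws)) = sc (c s * d) * (B s * P)"
        by (simp only: dP(3) sc_mult_mult)
      moreover have "(c s * d) ^ N = 1" using N(2)[of "c s"] s dP(1) by (simp add: power_mult_distrib)
      moreover have "B s * P \<in> words T" using s dP(2) by (intro words.mult) (auto simp: T_def)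
      ultimately show ?case by blast
    qed
    then show "M \<in> (\<lambda>(d, M). sc d * M) ` ({d. d ^ N = 1} \<times> words T)" using ws(2) by force
  qed
  moreover have "finite {d :: complex. d ^ N = 1}"
    using N(1) by (intro finite_roots_unity) simp
  ultimately show ?thesis using \<open>finite (words T)\<close> by (meson finite_SigmaI finite_surj)
qed

text \<open>Two powers coincide by the pigeonhole principle. The target is only a monoid, so
  cancellation uses powers of \<open>\<psi> (inv g)\<close>.\<close>

lemma finite_order_if_finite_image:
  fixes \<psi> :: "'a \<Rightarrow> 'c::monoid_mult"
  assumes \<psi>_mult: "\<And>g h. g \<in> carrier G \<Longrightarrow> h \<in> carrier G \<Longrightarrow> \<psi> (g \<otimes> h) = \<psi> g * \<psi> h"
    and \<psi>_one: "\<psi> \<one> = 1" and fin: "finite (\<psi> ` carrier G)" and g: "g \<in> carrier G"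
  shows "finite_order (\<psi> g)"
proof -
  have pow: "\<psi> g ^ n = \<psi> (g [^] n)" for n :: nat
    using g by (induction n) (simp_all add: \<psi>_one \<psi>_mult power_Suc2 del: power_Suc)
  have "range (\<lambda>n::nat. \<psi> g ^ n) \<subseteq> \<psi> ` carrier G"
    using g by (auto simp: pow)
  then have "\<not> inj (\<lambda>n::nat. \<psi> g ^ n)"
    using fin finite_subset finite_imageD by (metis infinite_UNIV_nat)
  then obtain i j :: nat where ij: "i < j" "\<psi> g ^ i = \<psi> g ^ j"
    unfolding inj_def by (metis linorder_neqE_nat)
  have "\<psi> (inv g) * \<psi> g = 1" using \<psi>_mult[of "inv g" g] g \<psi>_one by simp
  then have inv: "\<psi> (inv g) ^ i * \<psi> g ^ i = 1" by (rule left_right_inverse_power)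
  have "\<psi> g ^ i * \<psi> g ^ (j - i) = \<psi> g ^ i"
    using ij(1) by (simp add: ij(2)[symmetric] flip: power_add)
  then have "\<psi> (inv g) ^ i * \<psi> g ^ i * \<psi> g ^ (j - i) = \<psi> (inv g) ^ i * \<psi> g ^ i"
    by (simp only: mult.assoc)
  then have "\<psi> g ^ (j - i) = 1" by (simp only: inv mult_1)
  then show ?thesis using ij(1) unfolding finite_order_def by (intro exI[of _ "j - i"]) simp
qed

end

section \<open>Transfer from \<open>GL2\<close> to \<open>m2\<close>\<close>

definition to_m2 :: "complex ^ 2 ^ 2 \<Rightarrow> m2" where
  "to_m2 A = M2 (A $ 1 $ 1) (A $ 1 $ 2) (A $ 2 $ 1) (A $ 2 $ 2)"

lemma inj_to_m2: "inj to_m2"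
  by (rule injI) (simp add: to_m2_def vec_eq_iff forall_2)

lemma to_m2_mult: "to_m2 (A ** B) = to_m2 A * to_m2 B"
  by (simp add: to_m2_def times_m2_def matrix_matrix_mult_def sum_2)

lemma to_m2_one: "to_m2 (mat 1) = 1"
  by (simp add: to_m2_def one_m2_def mat_def)

lemma to_m2_pow: "to_m2 (A [^]\<^bsub>GL2\<^esub> (n::nat)) = to_m2 A ^ n"
proof (induction n)
  case 0
  show ?case by (simp add: nat_pow_def GL2_def to_m2_one)
next
  case (Suc n)
  then show ?case by (simp add: nat_pow_def GL2_def to_m2_mult power_commutes)
qed

lemma is_torsion_GL2_iff: "is_torsion GL2 A \<longleftrightarrow> finite_order (to_m2 A)"
proof -
  have "A [^]\<^bsub>GL2\<^esub> n = \<one>\<^bsub>GL2\<^esub> \<longleftrightarrow> to_m2 A ^ n = 1" for n :: nat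
    using inj_eq[OF inj_to_m2, of "A [^]\<^bsub>GL2\<^esub> n" "mat 1"]
    by (simp only: to_m2_pow to_m2_one) (simp add: GL2_def)
  then show ?thesis by (auto simp: is_torsion_def finite_order_def)
qed

theorem theorem1p4:
  fixes F :: "('a, 'm) monoid_scheme" and S :: "'a set"
  assumes "group F"
    and "S \<subseteq> carrier F"
    and "finite S"
    and "generate F S = carrier F"
  shows "burnside_set F (Hom F GL2) {g \<in> carrier F. word_length F S g \<le> 3 * card S}"
proof -
  interpret group F by (rule assms(1))
  have "(\<forall>\<gamma>\<in>{g \<in> carrier F. word_length F S g \<le> 3 * card S}. is_torsion GL2 (\<rho> \<gamma>))
      \<longleftrightarrow> finite (\<rho> ` carrier F)" if \<rho>: "\<rho> \<in> hom F GL2" for \<rho>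
  proof -
    interpret \<rho>: group_hom F GL2 \<rho>
      using \<rho> by (simp add: group_hom_def group_hom_axioms_def assms(1) group_GL2)
    define \<psi> where "\<psi> g = to_m2 (\<rho> g)" for g
    have mult: "\<psi> (g \<otimes>\<^bsub>F\<^esub> h) = \<psi> g * \<psi> h" if "g \<in> carrier F" "h \<in> carrier F" for g h
      using \<rho>.hom_mult[OF that] by (simp add: \<psi>_def GL2_def to_m2_mult)
    have one: "\<psi> \<one>\<^bsub>F\<^esub> = 1"
      using \<rho>.hom_one by (simp add: \<psi>_def GL2_def to_m2_one)
    have "\<psi> ` carrier F = to_m2 ` (\<rho> ` carrier F)" by (auto simp: \<psi>_def)
    then have fin: "finite (\<rho> ` carrier F) \<longleftrightarrow> finite (\<psi> ` carrier F)"
      using finite_image_iff[of to_m2] inj_to_m2 by (metis inj_on_subset subset_UNIV)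
    show ?thesis
      unfolding fin is_torsion_GL2_iff \<psi>_def[symmetric]
      using finite_image_if_short_words_finite_order[OF assms(2-4) mult one]
        finite_order_if_finite_image[OF mult one] by blast
  qed
  then show ?thesis
    using hom_class_Hom[OF group_GL2] by (auto simp: burnside_set_def Hom_def)
qed

end
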